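(* Let the sequence $\{x^t\}$ be generated by algorithm AEPG-SPIDER (described in the context) under the standing assumptions. There is a positive constant $\overline{\mathrm v}$ (independent of $t$ and $T$) with $\mathbb E[\mathcal V_t]\le\overline{\mathrm v}$ for all $t\ge0$, such that for every integer $T\ge1$: (a) $\mathbb E\big[\sum_{t=0}^T\|x^{t+1}-x^t\|_2^2\big]\le\overline{\mathrm X}\triangleq\frac1\alpha\big((\overline{\mathrm v}/\underline{\mathrm v})^2-1\big)$. (b) $\mathbb E\big[\frac1{T+1}\sum_{t=0}^T\|\nabla f(x^{t+1})+\partial h(x^{t+1})\|\big]\le\mathcal O(1/\sqrt T)$, where the hidden constant does not depend on $T$. In other words, there is a constant $C>0$ independent of $\epsilon$ and $T$ such that for every $\epsilon>0$, if $T\ge C/\epsilon^2$ then there exists $\bar t\in\{1,\dots,T\}$ with $\mathbb E[\|\nabla f(x^{\bar t})+\partial h(x^{\bar t})\|]\le\epsilon$. (c) Assume $b=q=\sqrt N$. Then the total iteration complexity (number of evaluations of component gradients $\nabla f_i$) required to find an $\epsilon$-approximate critical point, i.e. a point $x^{\bar t}$ satisfying $\mathbb E[\|\nabla f(x^{\bar t})+\partial h(x^{\bar t})\|]\le\epsilon$, is $\mathcal O(N+\sqrt N\,\epsilon^{-2})$, where $\mathcal O(\cdot)$ hides constants not depending on $N$ and $\epsilon$.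
   Context: Problem: minimize $F(x)=f(x)+h(x)$ over $x\in\mathbb R^n$, where $f=\frac1N\sum_{i=1}^N f_i$, each $f_i:\mathbb R^n\to\mathbb R$ is differentiable (possibly nonconvex), and $h:\mathbb R^n\to(-\infty,+\infty]$ is proper and lower semicontinuous (possibly nonconvex, nonsmooth). Notation: vector operations ($\odot$ product, $\div$ division, square root) and inequalities are componentwise; $\mathbf 1$ is the all-ones vector; $\min(v),\max(v)$ are the smallest and largest entries of a vector $v$; $\|x\|=\|x\|_2$; $\|x\|_v^2=\sum_i x_i^2v_i$ for $v\ge 0$; $\partial h$ is the limiting subdifferential, and $\|\nabla f(x)+\partial h(x)\|$ denotes $\inf\{\|\nabla f(x)+\xi\|:\xi\in\partial h(x)\}$. $\mathbb E$ is expectation over all the random mini-batches. Standing assumptions: (1) the generalized proximal operator $\mathrm{Prox}_h(a;v)\triangleq\arg\min_x h(x)+\frac12\|x-a\|_v^2$ is nonempty (can be computed exactly) for all $a\in\mathbb R^n$ and all $v\in\mathbb R^n$ with positive entries; (2) there is $\overline{\mathrm x}>0$ with $\|x\|\le\overline{\mathrm x}$ for all $x\in\mathrm{dom}(F)$, and $\min_xF(x)>-\infty$; (3) each $f_j$ is $L$-smooth: $\|\nabla f_j(x)-\nabla f_j(\tilde x)\|\le L\|x-\tilde x\|$ for all $x,\tilde x$. Algorithm AEPG-SPIDER: parameters $\underline{\mathrm v}>0$, $\alpha>0$, $\beta\ge0$, $\theta\in[0,1)$, integers $q\ge1$ (frequency) and $b\ge1$ (mini-batch size); initial point $x^0\in\mathrm{dom}(F)$,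 $x^{-1}=x^0$, $v^0=\underline{\mathrm v}\mathbf 1$, $y^0=x^0$, $\sigma^{-1}=\theta$. For $t=0,1,2,\dots$: if $q$ divides $t$, $g^t=\nabla f(y^t)$; otherwise $g^t=g^{t-1}+\nabla f(y^t;\mathcal I^t)-\nabla f(y^{t-1};\mathcal I^t)$, where $\mathcal I^t$ is a fresh mini-batch of $b$ indices sampled uniformly at random with replacement from $\{1,\dots,N\}$ and $\nabla f(y;\mathcal I)$ is the average of $\nabla f_i(y)$ over $i\in\mathcal I$. Then $x^{t+1}\in\mathrm{Prox}_h(y^t-g^t\div v^t;v^t)$; $d^t=x^{t+1}-x^t$; $r^t=v^t\odot d^t$; $s^t=\alpha\|r^t\|_2^2\mathbf 1+\beta\, r^t\odot r^t$; $v^{t+1}=\sqrt{v^0\odot v^0+\sum_{i=0}^t s^i}$; $\sigma^t=\theta(1-\sigma^{t-1})\min(v^t\div v^{t+1})$; $y^{t+1}=x^{t+1}+\sigma^t d^t$. Define $\mathcal R_t=\sum_{i=0}^t\|r^i\|_2^2$, $\mathcal V_{t+1}=\sqrt{\underline{\mathrm v}^2+(\alpha+\beta)\mathcal R_t}$ for $t\ge0$, and $\mathcal V_0=\underline{\mathrm v}$. In part (c), $L$, $\overline{\mathrm x}$, the initial gap and the parameters $\underline{\mathrm v},\alpha,\beta,\theta$ are regarded as fixed. *)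

theory Defs
  imports "HOL-Probability.Probability" "HOL-Probability.Stopping_Time"
begin

section \<open>Nonsmooth analysis in Euclidean space\<close>

text \<open>
  On \<^typ>\<open>real ^ 'n\<close> the library's \<open>*\<close> is the componentwise product and \<open>1\<close> is the
  all-ones vector; the two remaining componentwise operations are added here.
\<close>

definition vdiv :: "real ^ 'n \<Rightarrow> real ^ 'n \<Rightarrow> real ^ 'n" where
  "vdiv u w = (\<chi> i. u $ i / w $ i)"

definition vsqrt :: "real ^ 'n \<Rightarrow> real ^ 'n" where
  "vsqrt u = (\<chi> i. sqrt (u $ i))"

definition vmin :: "real ^ 'n \<Rightarrow> real" where
  "vmin u = Min (range (\<lambda>i. u $ i))"

definition wnorm_sq :: "real ^ 'n \<Rightarrow> real ^ 'n \<Rightarrow> real" where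
  "wnorm_sq w u = (\<Sum>i\<in>UNIV. (u $ i)\<^sup>2 * w $ i)"

definition grad :: "('a::real_inner \<Rightarrow> real) \<Rightarrow> 'a \<Rightarrow> 'a" where
  "grad f x = (THE D. GDERIV f x :> D)"

definition proper_fun :: "('a \<Rightarrow> ereal) \<Rightarrow> bool" where
  "proper_fun h \<longleftrightarrow> (\<forall>x. h x \<noteq> - \<infinity>) \<and> (\<exists>x. h x \<noteq> \<infinity>)"

definition lsc_fun :: "('a::topological_space \<Rightarrow> ereal) \<Rightarrow> bool" where
  "lsc_fun h \<longleftrightarrow> (\<forall>x. h x \<le> Liminf (at x) h)"

text \<open>The regular (Frechet) subdifferential; it is empty outside the domain of \<open>h\<close>.\<close>

definition frechet_subdiff :: "('a::real_inner \<Rightarrow> ereal) \<Rightarrow> 'a \<Rightarrow> 'a set" where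
  "frechet_subdiff h x =
     {\<xi>. \<bar>h x\<bar> \<noteq> \<infinity> \<and>
         0 \<le> Liminf (at x) (\<lambda>z. (h z - h x - ereal (inner \<xi> (z - x))) / ereal (norm (z - x)))}"

definition limiting_subdiff :: "('a::real_inner \<Rightarrow> ereal) \<Rightarrow> 'a \<Rightarrow> 'a set" where
  "limiting_subdiff h x =
     {\<xi>. \<bar>h x\<bar> \<noteq> \<infinity> \<and>
         (\<exists>z \<zeta>. z \<longlonglongrightarrow> x \<and> (\<lambda>k. h (z k)) \<longlonglongrightarrow> h x \<and>
                (\<forall>k. \<zeta> k \<in> frechet_subdiff h (z k)) \<and> \<zeta> \<longlonglongrightarrow> \<xi>)}"

definition prox :: "(real ^ 'n \<Rightarrow> ereal) \<Rightarrow> real ^ 'n \<Rightarrow> real ^ 'n \<Rightarrow> (real ^ 'n) set" where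
  "prox h a w =
     {x. is_arg_min (\<lambda>x. h x + ereal (1 / 2 * wnorm_sq w (x - a))) (\<lambda>_. True) x}"


section \<open>The composite finite-sum problem\<close>

definition favg :: "nat \<Rightarrow> (nat \<Rightarrow> 'a \<Rightarrow> real) \<Rightarrow> 'a \<Rightarrow> real" where
  "favg N f x = (1 / real N) * (\<Sum>i\<in>{1..N}. f i x)"

definition objective :: "nat \<Rightarrow> (nat \<Rightarrow> 'a \<Rightarrow> real) \<Rightarrow> ('a \<Rightarrow> ereal) \<Rightarrow> 'a \<Rightarrow> ereal" where
  "objective N f h x = ereal (favg N f x) + h x"

definition dom_objective :: "nat \<Rightarrow> (nat \<Rightarrow> 'a \<Rightarrow> real) \<Rightarrow> ('a \<Rightarrow> ereal) \<Rightarrow> 'a set" where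
  "dom_objective N f h = {x. objective N f h x < \<infinity>}"

text \<open>
  The distance of \<open>- \<nabla>f x\<close> to \<open>\<partial>h x\<close>. It takes values in \<^typ>\<open>ennreal\<close>, so that it is
  \<open>\<infinity>\<close> when the subdifferential is empty.
\<close>

definition crit_residual ::
  "nat \<Rightarrow> (nat \<Rightarrow> 'a::real_inner \<Rightarrow> real) \<Rightarrow> ('a \<Rightarrow> ereal) \<Rightarrow> 'a \<Rightarrow> ennreal" where
  "crit_residual N f h x =
     (INF \<xi>\<in>limiting_subdiff h x. ennreal (norm (grad (favg N f) x + \<xi>)))"

locale composite_problem =
  fixes N :: nat
    and f :: "nat \<Rightarrow> real ^ 'n \<Rightarrow> real"
    and h :: "real ^ 'n \<Rightarrow> ereal"
    and L xbar :: real
  assumes N_pos: "N \<ge> 1"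
    and f_differentiable: "\<And>i x. i \<in> {1..N} \<Longrightarrow> f i differentiable (at x)"
    and h_proper: "proper_fun h"
    and h_lsc: "lsc_fun h"
    and prox_nonempty: "\<And>a w. (\<And>i. w $ i > 0) \<Longrightarrow> prox h a w \<noteq> {}"
    and xbar_pos: "xbar > 0"
    and dom_bounded: "\<And>x. x \<in> dom_objective N f h \<Longrightarrow> norm x \<le> xbar"
    and objective_bounded_below: "(INF x. objective N f h x) > - \<infinity>"
    and L_smooth: "\<And>i x z. i \<in> {1..N} \<Longrightarrow> norm (grad (f i) x - grad (f i) z) \<le> L * norm (x - z)"


section \<open>The algorithm AEPG-SPIDER\<close>

text \<open>A mini-batch is a tuple of \<open>b\<close> indices, represented as a function on \<open>{..<b}\<close>.\<close>

definition batch_grad ::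
  "(nat \<Rightarrow> real ^ 'n \<Rightarrow> real) \<Rightarrow> nat \<Rightarrow> (nat \<Rightarrow> nat) \<Rightarrow> real ^ 'n \<Rightarrow> real ^ 'n" where
  "batch_grad f b J y = (1 / real b) *\<^sub>R (\<Sum>k<b. grad (f (J k)) y)"

text \<open>The law of \<open>b\<close> independent uniform draws (with replacement) from \<open>{1..N}\<close>.\<close>

definition batch_law :: "nat \<Rightarrow> nat \<Rightarrow> (nat \<Rightarrow> nat) measure" where
  "batch_law N b = Pi\<^sub>M {..<b} (\<lambda>_. uniform_count_measure {1..N})"

definition d_seq :: "(nat \<Rightarrow> 'w \<Rightarrow> real ^ 'n) \<Rightarrow> nat \<Rightarrow> 'w \<Rightarrow> real ^ 'n" where
  "d_seq x t \<omega> = x (Suc t) \<omega> - x t \<omega>"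

definition r_seq ::
  "(nat \<Rightarrow> 'w \<Rightarrow> real ^ 'n) \<Rightarrow> (nat \<Rightarrow> 'w \<Rightarrow> real ^ 'n) \<Rightarrow> nat \<Rightarrow> 'w \<Rightarrow> real ^ 'n" where
  "r_seq x v t \<omega> = v t \<omega> * d_seq x t \<omega>"

definition s_seq ::
  "real \<Rightarrow> real \<Rightarrow> (nat \<Rightarrow> 'w \<Rightarrow> real ^ 'n) \<Rightarrow> (nat \<Rightarrow> 'w \<Rightarrow> real ^ 'n) \<Rightarrow> nat \<Rightarrow> 'w \<Rightarrow> real ^ 'n" where
  "s_seq \<alpha> \<beta> x v t \<omega> =
     (\<alpha> * (norm (r_seq x v t \<omega>))\<^sup>2) *\<^sub>R 1 + \<beta> *\<^sub>R (r_seq x v t \<omega> * r_seq x v t \<omega>)"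

definition R_cal :: "(nat \<Rightarrow> 'w \<Rightarrow> real ^ 'n) \<Rightarrow> (nat \<Rightarrow> 'w \<Rightarrow> real ^ 'n) \<Rightarrow> nat \<Rightarrow> 'w \<Rightarrow> real" where
  "R_cal x v t \<omega> = (\<Sum>i\<le>t. (norm (r_seq x v i \<omega>))\<^sup>2)"

primrec V_cal ::
  "real \<Rightarrow> real \<Rightarrow> real \<Rightarrow> (nat \<Rightarrow> 'w \<Rightarrow> real ^ 'n) \<Rightarrow> (nat \<Rightarrow> 'w \<Rightarrow> real ^ 'n) \<Rightarrow> nat \<Rightarrow> 'w \<Rightarrow> real" where
  "V_cal vlow \<alpha> \<beta> x v 0 \<omega> = vlow"
| "V_cal vlow \<alpha> \<beta> x v (Suc t) \<omega> = sqrt (vlow\<^sup>2 + (\<alpha> + \<beta>) * R_cal x v t \<omega>)"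

text \<open>
  A run of the algorithm. \<open>Fil t\<close> is the information available before the mini-batch
  \<open>I t\<close> is drawn; freshness of that mini-batch means independence from \<open>Fil t\<close>. The iterate
  \<open>x (Suc t)\<close> is an arbitrary element of the (possibly multivalued) proximal set, chosen
  from the information in \<open>Fil (Suc t)\<close>. The remaining processes are determined by \<open>x\<close>
  and \<open>I\<close>. A mini-batch is drawn only in those iterations that do not evaluate the full
  gradient. The conventional value \<open>\<theta>\<close> of \<open>sigma\<close> at time \<open>-1\<close> appears in \<open>sigma_step\<close>;
  the iterates at time \<open>-1\<close> are never used, since \<open>q\<close> divides \<open>0\<close>.
\<close>

locale aepg_spider =
  composite_problem N f h L xbar + prob_space M + filtration "space M" Fil
  for N :: nat and f :: "nat \<Rightarrow> real ^ 'n \<Rightarrow> real" and h :: "real ^ 'n \<Rightarrow> ereal"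
    and L xbar :: real
    and M :: "'w measure" and Fil :: "nat \<Rightarrow> 'w measure" +
  fixes vlow \<alpha> \<beta> \<theta> :: real
    and q b :: nat
    and x0 :: "real ^ 'n"
    and I :: "nat \<Rightarrow> 'w \<Rightarrow> nat \<Rightarrow> nat"
    and x y v g :: "nat \<Rightarrow> 'w \<Rightarrow> real ^ 'n"
    and sigma :: "nat \<Rightarrow> 'w \<Rightarrow> real"
  assumes vlow_pos: "vlow > 0"
    and \<alpha>_pos: "\<alpha> > 0"
    and \<beta>_nonneg: "\<beta> \<ge> 0"
    and \<theta>_range: "0 \<le> \<theta>" "\<theta> < 1"
    and q_pos: "q \<ge> 1"
    and b_pos: "b \<ge> 1"
    and x0_dom: "x0 \<in> dom_objective N f h"
    and Fil_sub: "\<And>t. sets (Fil t) \<subseteq> sets M"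
    and x_adapted: "\<And>t. x t \<in> borel_measurable (Fil t)"
    and I_adapted: "\<And>t. \<not> q dvd t \<Longrightarrow> I t \<in> Fil (Suc t) \<rightarrow>\<^sub>M batch_law N b"
    and I_law: "\<And>t. \<not> q dvd t \<Longrightarrow> distr M (batch_law N b) (I t) = batch_law N b"
    and I_fresh: "\<And>t. \<not> q dvd t \<Longrightarrow>
          indep_set (sets (Fil t)) {I t -` A \<inter> space M | A. A \<in> sets (batch_law N b)}"
    and x_init: "\<And>\<omega>. \<omega> \<in> space M \<Longrightarrow> x 0 \<omega> = x0"
    and v_init: "\<And>\<omega>. \<omega> \<in> space M \<Longrightarrow> v 0 \<omega> = vlow *\<^sub>R 1"
    and y_init: "\<And>\<omega>. \<omega> \<in> space M \<Longrightarrow> y 0 \<omega> = x0"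
    and g_full: "\<And>t \<omega>. \<omega> \<in> space M \<Longrightarrow> q dvd t \<Longrightarrow> g t \<omega> = grad (favg N f) (y t \<omega>)"
    and g_batch: "\<And>t \<omega>. \<omega> \<in> space M \<Longrightarrow> \<not> q dvd t \<Longrightarrow>
          g t \<omega> = g (t - 1) \<omega> + batch_grad f b (I t \<omega>) (y t \<omega>)
                  - batch_grad f b (I t \<omega>) (y (t - 1) \<omega>)"
    and x_step: "\<And>t \<omega>. \<omega> \<in> space M \<Longrightarrow>
          x (Suc t) \<omega> \<in> prox h (y t \<omega> - vdiv (g t \<omega>) (v t \<omega>)) (v t \<omega>)"
    and v_step: "\<And>t \<omega>. \<omega> \<in> space M \<Longrightarrow>
          v (Suc t) \<omega> = vsqrt (v 0 \<omega> * v 0 \<omega> + (\<Sum>i\<le>t. s_seq \<alpha> \<beta> x v i \<omega>))"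
    and sigma_step: "\<And>t \<omega>. \<omega> \<in> space M \<Longrightarrow>
          sigma t \<omega> = \<theta> * (1 - (if t = 0 then \<theta> else sigma (t - 1) \<omega>))
                        * vmin (vdiv (v t \<omega>) (v (Suc t) \<omega>))"
    and y_step: "\<And>t \<omega>. \<omega> \<in> space M \<Longrightarrow>
          y (Suc t) \<omega> = x (Suc t) \<omega> + sigma t \<omega> *\<^sub>R d_seq x t \<omega>"

text \<open>
  The number of component gradients evaluated in iterations \<open>0, \<dots>, T - 1\<close>, that is, to
  produce \<open>x T\<close>: a full gradient costs \<open>N\<close>, and a mini-batch step evaluates \<open>b\<close> component
  gradients at each of two points.
\<close>

definition grad_evals :: "nat \<Rightarrow> nat \<Rightarrow> nat \<Rightarrow> nat \<Rightarrow> nat" where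
  "grad_evals N q b T = (\<Sum>t<T. if q dvd t then N else 2 * b)"

end

theory Submission
  imports Defs
begin

text \<open>
  The proximal inequality and \<open>\<sigma>\<^sup>t v\<^sup>t\<^sup>+\<^sup>1 \<le> \<theta> (1 - \<sigma>\<^sup>t\<^sup>-\<^sup>1) v\<^sup>t\<close> make
  \<open>P\<^sub>t = (1 - \<sigma>\<^sup>t\<^sup>-\<^sup>1) \<parallel>d\<^sup>t\<parallel>\<^sup>2 / 2\<close> (norm weighted by \<open>v\<^sup>t\<close>) a potential: up to the gradient
  error, \<open>F + \<theta> P\<close> decreases by \<open>(1 - \<theta>) P\<^sub>t\<close>, modulo a multiple of \<open>\<parallel>d\<^sup>t\<parallel>\<^sup>2\<close>. The sum of the \<open>P\<^sub>t\<close>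
  dominates \<open>\<V>\<^sub>T\<close>, whereas \<open>\<Sum> \<parallel>d\<^sup>t\<parallel>\<^sup>2\<close> is only of order \<open>ln \<V>\<^sub>T\<close>, because \<open>v\<^sup>t\<close> is at least
  of order \<open>sqrt \<R>\<^sub>t\<^sub>-\<^sub>1\<close> and the domain is bounded. The mini-batch errors have total variance at
  most a multiple of \<open>q / b\<close> times \<open>E \<Sum> \<parallel>d\<^sup>t\<parallel>\<^sup>2\<close>. Hence \<open>E \<V>\<^sub>T\<close> is bounded by a constant plus a
  multiple of \<open>E ln \<V>\<^sub>T\<close>, and so by a constant. Finally the residual at \<open>x\<^sup>t\<^sup>+\<^sup>1\<close> is controlled by the error,
  \<open>d\<close> and \<open>r\<close> at times \<open>t - 1\<close> and \<open>t\<close>, all of which are square summable in the mean or satisfy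
  \<open>\<Sum> \<parallel>r\<^sup>t\<parallel>\<^sup>2 \<le> \<V>\<^sub>T\<^sup>2 / (\<alpha> + \<beta>)\<close>, so that the Cauchy-Schwarz inequality gives the rate.
\<close>

subsection \<open>Gradients, sampling and proximal steps\<close>

lemma grad_eqI:
  assumes "GDERIV f x :> D"
  shows "grad f x = D"
  unfolding grad_def
proof (rule the_equality)
  show "GDERIV f x :> D" by fact
next
  fix D' assume "GDERIV f x :> D'"
  then have eq: "(\<lambda>h. inner h D') = (\<lambda>h. inner h D)"
    using assms unfolding gderiv_def by (rule has_derivative_unique)
  have "\<forall>h. inner h D' = inner h D" by (intro allI) (rule fun_cong[OF eq])
  then show "D' = D" using vector_eq_ldot[of D' D] by (simp only: inner_commute)
qed

text \<open>The derivative is a linear functional, and its Riesz vector is assembled from its values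
  on the orthonormal basis; the description operator in \<open>grad\<close> therefore denotes the
  true gradient.\<close>

lemma GDERIV_grad:
  fixes f :: "'a::euclidean_space \<Rightarrow> real"
  assumes "f differentiable (at x)"
  shows "GDERIV f x :> grad f x"
proof -
  obtain f' where f': "(f has_derivative f') (at x)"
    using assms unfolding differentiable_def by blast
  interpret f': bounded_linear f' using f' by (rule has_derivative_bounded_linear)
  define D where "D = (\<Sum>b\<in>Basis. f' b *\<^sub>R b)"
  have "f' z = inner z D" for z
  proof -
    have "f' z = f' (\<Sum>b\<in>Basis. inner z b *\<^sub>R b)" by (simp add: euclidean_representation)
    also have "\<dots> = (\<Sum>b\<in>Basis. inner z b * f' b)" by (simp add: f'.sum f'.scaleR)
    also have "\<dots> = inner z D" by (simp add: D_def inner_sum_right mult.commute)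
    finally show ?thesis .
  qed
  then have "f' = (\<lambda>z. inner z D)" by blast
  then have "GDERIV f x :> D" using f' unfolding gderiv_def by simp
  then show ?thesis using grad_eqI by metis
qed

text \<open>Mean value theorem along the segment from \<open>x\<close> to \<open>z\<close>, then
  Cauchy-Schwarz and the Lipschitz bound at the intermediate point. This gives the factor
  \<open>L\<close> rather than the sharp \<open>L / 2\<close>, which affects only the
  constants.\<close>

lemma lipschitz_grad_descent:
  fixes f :: "'a::euclidean_space \<Rightarrow> real"
  assumes diff: "\<And>x. f differentiable (at x)"
    and lip: "\<And>x z. norm (grad f x - grad f z) \<le> L * norm (x - z)"
    and L: "L \<ge> 0"
  shows "f z \<le> f x + inner (grad f x) (z - x) + L * (norm (z - x))\<^sup>2"
proof -
  define \<phi> where "\<phi> s = f (x + s *\<^sub>R (z - x))" for s :: real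
  have der: "(\<phi> has_derivative (\<lambda>u. u * inner (z - x) (grad f (x + s *\<^sub>R (z - x))))) (at s)" for s
  proof -
    have "(f has_derivative (\<lambda>u. inner u (grad f (x + s *\<^sub>R (z - x))))) (at (x + s *\<^sub>R (z - x)))"
      using GDERIV_grad[OF diff] unfolding gderiv_def .
    moreover have "((\<lambda>s. x + s *\<^sub>R (z - x)) has_derivative (\<lambda>u. u *\<^sub>R (z - x))) (at s)"
      by (auto intro!: derivative_eq_intros)
    ultimately have "((f \<circ> (\<lambda>s. x + s *\<^sub>R (z - x))) has_derivative
        ((\<lambda>u. inner u (grad f (x + s *\<^sub>R (z - x)))) \<circ> (\<lambda>u. u *\<^sub>R (z - x)))) (at s)"
      using diff_chain_at by blast
    moreover have "\<phi> = (\<lambda>s. f (x + s *\<^sub>R (z - x)))" by (simp add: \<phi>_def fun_eq_iff)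
    ultimately show ?thesis by (simp add: o_def)
  qed
  have "\<exists>s\<in>{0..1}. \<phi> 1 - \<phi> 0 = (1 - 0) * inner (z - x) (grad f (x + s *\<^sub>R (z - x)))"
    by (rule mvt_very_simple) (auto intro: has_derivative_at_withinI der)
  then obtain s where s: "0 \<le> s" "s \<le> 1"
    "f z - f x = inner (z - x) (grad f (x + s *\<^sub>R (z - x)))"
    by (auto simp: \<phi>_def)
  have "inner (z - x) (grad f (x + s *\<^sub>R (z - x)) - grad f x)
      \<le> norm (z - x) * norm (grad f (x + s *\<^sub>R (z - x)) - grad f x)"
    by (rule norm_cauchy_schwarz)
  also have "\<dots> \<le> norm (z - x) * (L * norm (s *\<^sub>R (z - x)))"
    using lip[of "x + s *\<^sub>R (z - x)" x] by (intro mult_left_mono) auto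
  also have "\<dots> \<le> norm (z - x) * (L * norm (z - x))"
    using s L by (intro mult_left_mono) (auto intro: mult_left_le_one_le)
  finally show ?thesis using s(3)
    by (simp add: inner_diff_right inner_commute power2_eq_square algebra_simps)
qed

section \<open>Second moments of sampled sums\<close>

text \<open>Separates one draw from the other \<open>b\<close>, which prepares an induction on the
  batch size.\<close>

lemma sum_PiE_Suc:
  fixes F :: "(nat \<Rightarrow> 'i) \<Rightarrow> 'a::comm_monoid_add"
  assumes "finite A"
  shows "sum F (PiE {..<Suc b} (\<lambda>_. A)) = (\<Sum>i\<in>A. \<Sum>J\<in>PiE {..<b} (\<lambda>_. A). F (J(b := i)))"
proof -
  have "sum F (PiE {..<Suc b} (\<lambda>_. A))
      = sum F ((\<lambda>(i, J). J(b := i)) ` (A \<times> PiE {..<b} (\<lambda>_. A)))"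
    by (simp add: lessThan_Suc PiE_insert_eq)
  also have "\<dots> = sum (F \<circ> (\<lambda>(i, J). J(b := i))) (A \<times> PiE {..<b} (\<lambda>_. A))"
    by (rule sum.reindex, rule inj_combinator) simp
  finally show ?thesis by (simp add: sum.cartesian_product case_prod_unfold)
qed

text \<open>The cross terms vanish because the draws are independent and centred.\<close>

lemma sum_norm_sq_sampling:
  fixes w :: "'i \<Rightarrow> 'a::real_inner"
  assumes fin: "finite A" and ne: "A \<noteq> {}" and zero: "(\<Sum>i\<in>A. w i) = 0"
  shows "(\<Sum>J\<in>PiE {..<b} (\<lambda>_. A). (norm (u + (\<Sum>k<b. w (J k))))\<^sup>2)
       = real (card A) ^ b * ((norm u)\<^sup>2 + real b * (\<Sum>i\<in>A. (norm (w i))\<^sup>2) / real (card A))"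
proof (induction b arbitrary: u)
  case 0
  then show ?case by simp
next
  case (Suc b)
  let ?P = "PiE {..<b} (\<lambda>_. A)" and ?c = "real (card A)"
  have c: "?c > 0" using fin ne by (simp add: card_gt_0_iff)
  have "(\<Sum>J\<in>PiE {..<Suc b} (\<lambda>_. A). (norm (u + (\<Sum>k<Suc b. w (J k))))\<^sup>2)
      = (\<Sum>i\<in>A. \<Sum>J\<in>?P. (norm (u + w i + (\<Sum>k<b. w (J k))))\<^sup>2)"
    by (subst sum_PiE_Suc[OF fin]) (simp add: algebra_simps)
  also have "\<dots> = (\<Sum>i\<in>A. ?c ^ b * ((norm (u + w i))\<^sup>2 + real b * (\<Sum>i\<in>A. (norm (w i))\<^sup>2) / ?c))"
    by (simp add: Suc.IH)
  also have "\<dots> = ?c ^ b * ((\<Sum>i\<in>A. (norm (u + w i))\<^sup>2) + real b * (\<Sum>i\<in>A. (norm (w i))\<^sup>2))"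
    using c by (simp add: sum_distrib_left[symmetric] sum.distrib)
  also have "(\<Sum>i\<in>A. (norm (u + w i))\<^sup>2) = ?c * (norm u)\<^sup>2 + (\<Sum>i\<in>A. (norm (w i))\<^sup>2)"
  proof -
    have "(\<Sum>i\<in>A. (norm (u + w i))\<^sup>2) = (\<Sum>i\<in>A. (norm u)\<^sup>2 + 2 * inner u (w i) + (norm (w i))\<^sup>2)"
      by (simp add: power2_norm_eq_inner inner_simps inner_commute algebra_simps)
    also have "\<dots> = ?c * (norm u)\<^sup>2 + 2 * inner u (\<Sum>i\<in>A. w i) + (\<Sum>i\<in>A. (norm (w i))\<^sup>2)"
      by (simp add: sum.distrib inner_sum_right sum_distrib_left)
    finally show ?thesis by (simp add: zero)
  qed
  finally show ?case using c by (simp add: field_simps)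
qed

text \<open>The variance is at most the second moment, written with sums over a finite population
  instead of expectations.\<close>

lemma sum_norm_sq_centred_le:
  fixes u :: "'i \<Rightarrow> 'a::real_inner"
  assumes fin: "finite A" and ne: "A \<noteq> {}"
    and mean: "(\<Sum>i\<in>A. u i) = real (card A) *\<^sub>R m"
  shows "(\<Sum>i\<in>A. (norm (u i - m))\<^sup>2) \<le> (\<Sum>i\<in>A. (norm (u i))\<^sup>2)"
proof -
  have "(\<Sum>i\<in>A. (norm (u i - m))\<^sup>2) = (\<Sum>i\<in>A. (norm (u i))\<^sup>2 - 2 * inner (u i) m + (norm m)\<^sup>2)"
    by (simp add: power2_norm_eq_inner inner_simps inner_commute algebra_simps)
  also have "\<dots> = (\<Sum>i\<in>A. (norm (u i))\<^sup>2) - 2 * inner (\<Sum>i\<in>A. u i) m + real (card A) * (norm m)\<^sup>2"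
    by (simp add: sum.distrib sum_subtractf inner_sum_left sum_distrib_left)
  also have "\<dots> = (\<Sum>i\<in>A. (norm (u i))\<^sup>2) - real (card A) * (norm m)\<^sup>2"
    by (simp add: mean power2_norm_eq_inner)
  finally show ?thesis by simp
qed

section \<open>Weighted norms and componentwise products\<close>

lemma wnorm_sq_add:
  "wnorm_sq w (u + d) = wnorm_sq w u + 2 * inner (w * u) d + wnorm_sq w d"
proof -
  have "(u $ i + d $ i)\<^sup>2 * w $ i
      = (u $ i)\<^sup>2 * w $ i + 2 * ((w $ i * u $ i) * d $ i) + (d $ i)\<^sup>2 * w $ i" for i
    by (simp add: power2_eq_square algebra_simps)
  then show ?thesis
    by (simp add: wnorm_sq_def inner_vec_def sum.distrib sum_distrib_left)
qed

lemma wnorm_sq_nonneg: "(\<And>i. 0 \<le> w $ i) \<Longrightarrow> 0 \<le> wnorm_sq w u"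
  unfolding wnorm_sq_def by (intro sum_nonneg) simp

lemma norm_sq_vec: "(norm u)\<^sup>2 = (\<Sum>i\<in>UNIV. (u $ i)\<^sup>2)" for u :: "real ^ 'n"
  by (simp add: norm_vec_def L2_set_def sum_nonneg)

lemma wnorm_sq_le:
  assumes "\<And>i. w $ i \<le> m"
  shows "wnorm_sq w u \<le> m * (norm u)\<^sup>2"
  unfolding wnorm_sq_def norm_sq_vec sum_distrib_left
  by (rule sum_mono) (metis assms mult.commute mult_right_mono zero_le_power2)

lemma norm_mult_le:
  fixes u d :: "real ^ 'n"
  assumes "\<And>i. \<bar>u $ i\<bar> \<le> m"
  shows "norm (u * d) \<le> m * norm d"
proof -
  have m: "m \<ge> 0" using assms[of undefined] by linarith
  have "(norm (u * d))\<^sup>2 \<le> m\<^sup>2 * (norm d)\<^sup>2"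
    unfolding norm_sq_vec sum_distrib_left
  proof (rule sum_mono)
    fix i
    have "(u $ i)\<^sup>2 \<le> m\<^sup>2" using assms[of i] m by (simp add: abs_le_square_iff[symmetric])
    then show "((u * d) $ i)\<^sup>2 \<le> m\<^sup>2 * (d $ i)\<^sup>2"
      by (simp add: power_mult_distrib mult_right_mono)
  qed
  then show ?thesis using m by (simp add: power_mult_distrib[symmetric] power2_le_iff_abs_le)
qed

lemma norm_mult_ge:
  fixes u d :: "real ^ 'n"
  assumes m: "0 \<le> m" and "\<And>i. m \<le> u $ i"
  shows "m * norm d \<le> norm (u * d)"
proof -
  have "m\<^sup>2 * (norm d)\<^sup>2 \<le> (norm (u * d))\<^sup>2"
    unfolding norm_sq_vec sum_distrib_left
  proof (rule sum_mono)
    fix i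
    have "m\<^sup>2 \<le> (u $ i)\<^sup>2" using assms(2)[of i] m by (simp add: power_mono)
    then show "m\<^sup>2 * (d $ i)\<^sup>2 \<le> ((u * d) $ i)\<^sup>2"
      by (simp add: power_mult_distrib mult_right_mono)
  qed
  then show ?thesis using m by (simp add: power_mult_distrib[symmetric] power2_le_iff_abs_le)
qed

text \<open>Since \<open>0 \<le> w $ i \<le> m\<close> gives
  \<open>(w $ i)\<^sup>2 \<le> m * w $ i\<close>. It bounds the weighted norm from below by the
  scaled displacement, which links the potential to the growth of the weights.\<close>

lemma wnorm_sq_mult_ge:
  assumes pos: "\<And>i. 0 \<le> w $ i" and le: "\<And>i. w $ i \<le> m"
  shows "(norm (w * d))\<^sup>2 \<le> m * wnorm_sq w d"
  unfolding norm_sq_vec wnorm_sq_def sum_distrib_left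
proof (rule sum_mono)
  fix i
  have "(w $ i)\<^sup>2 \<le> m * w $ i"
    using pos[of i] le[of i] by (simp add: power2_eq_square mult_right_mono)
  then have "(w $ i)\<^sup>2 * (d $ i)\<^sup>2 \<le> m * w $ i * (d $ i)\<^sup>2" by (rule mult_right_mono) simp
  then show "((w * d) $ i)\<^sup>2 \<le> m * ((d $ i)\<^sup>2 * w $ i)"
    by (simp add: power_mult_distrib mult_ac)
qed

text \<open>Young's inequality for the weighted inner product, from the nonnegativity of the
  weighted square of \<open>d - u\<close>.\<close>

lemma inner_weighted_le:
  assumes "\<And>i. 0 \<le> w $ i"
  shows "2 * inner (w * u) d \<le> wnorm_sq w u + wnorm_sq w d"
  using wnorm_sq_nonneg[OF assms, of "d - u"] wnorm_sq_add[of w "- u" d]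
  by (simp add: wnorm_sq_def inner_vec_def sum_negf)

lemma vmin_le: "vmin u \<le> u $ i"
  unfolding vmin_def by (rule Min_le) auto

lemma vmin_attained: "\<exists>i. vmin u = u $ i"
proof -
  have "vmin u \<in> range (\<lambda>i. u $ i)" unfolding vmin_def by (rule Min_in) auto
  then show ?thesis by blast
qed

section \<open>Proximal minimisers and subgradients\<close>

lemma prox_le:
  assumes "p \<in> prox h a w"
  shows "h p + ereal (1 / 2 * wnorm_sq w (p - a)) \<le> h z + ereal (1 / 2 * wnorm_sq w (z - a))"
  using assms unfolding prox_def is_arg_min_def by (auto simp: not_less)

lemma prox_finite:
  assumes "p \<in> prox h a w" "h z < \<infinity>" "h p \<noteq> - \<infinity>"
  shows "\<bar>h p\<bar> \<noteq> \<infinity>"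
  using prox_le[OF assms(1), of z] assms(2,3) by (cases "h p"; cases "h z") auto

lemma frechet_subset_limiting: "frechet_subdiff h x \<subseteq> limiting_subdiff h x"
proof
  fix \<xi> assume "\<xi> \<in> frechet_subdiff h x"
  moreover from this have "\<bar>h x\<bar> \<noteq> \<infinity>" by (simp add: frechet_subdiff_def)
  ultimately show "\<xi> \<in> limiting_subdiff h x"
    unfolding limiting_subdiff_def
    by (intro CollectI conjI exI[of _ "\<lambda>_. x"] exI[of _ "\<lambda>_. \<xi>"]) auto
qed

text \<open>Minimality of \<open>p\<close>, with the quadratic expanded around \<open>p\<close>, is
  the subgradient inequality up to a remainder of second order in \<open>z - p\<close>. After
  division by the distance the remainder vanishes in the limit.\<close>

lemma prox_frechet_subdiff:
  fixes p :: "real ^ 'n"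
  assumes p: "p \<in> prox h a w" and fin: "\<bar>h p\<bar> \<noteq> \<infinity>" and pos: "\<And>i. 0 \<le> w $ i"
  shows "- (w * (p - a)) \<in> frechet_subdiff h p"
proof -
  \<comment> \<open>The sum of the weights is a crude common upper bound for all entries; any finite
    bound serves.\<close>
  define m where "m = (\<Sum>i\<in>UNIV. w $ i)"
  have wm: "w $ i \<le> m" for i unfolding m_def by (rule member_le_sum) (auto simp: pos)
  let ?\<xi> = "- (w * (p - a))"
  obtain hp where hp: "h p = ereal hp" using fin by auto
  have key: "ereal (- (m / 2) * norm (z - p))
      \<le> (h z - h p - ereal (inner ?\<xi> (z - p))) / ereal (norm (z - p))" if "z \<noteq> p" for z
  proof (cases "h z")
    case (real hz)
    have "wnorm_sq w (z - a) = wnorm_sq w (p - a) + 2 * inner (w * (p - a)) (z - p) + wnorm_sq w (z - p)"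
      using wnorm_sq_add[of w "p - a" "z - p"] by simp
    then have "hp \<le> hz + inner (w * (p - a)) (z - p) + 1 / 2 * wnorm_sq w (z - p)"
      using prox_le[OF p, of z] hp real by (simp add: field_simps)
    also have "wnorm_sq w (z - p) \<le> m * (norm (z - p))\<^sup>2" by (rule wnorm_sq_le) (rule wm)
    finally have *: "- (m / 2) * (norm (z - p))\<^sup>2 \<le> hz - hp - inner ?\<xi> (z - p)" by simp
    then have "- (m / 2) * norm (z - p) \<le> (hz - hp - inner ?\<xi> (z - p)) / norm (z - p)"
      using that by (simp add: pos_le_divide_eq power2_eq_square)
    then show ?thesis using hp real that by simp
  next
    case PInf
    then show ?thesis using hp that by simp
  next
    case MInf
    then show ?thesis using prox_le[OF p, of z] hp by simp
  qed
  have "((\<lambda>z. ereal (- (m / 2) * norm (z - p))) \<longlongrightarrow> ereal (- (m / 2) * norm (p - p))) (at p)"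
    by (intro tendsto_intros)
  then have lim: "Liminf (at p) (\<lambda>z. ereal (- (m / 2) * norm (z - p))) = 0"
    by (intro lim_imp_Liminf) (auto simp: zero_ereal_def)
  have "Liminf (at p) (\<lambda>z. ereal (- (m / 2) * norm (z - p)))
      \<le> Liminf (at p) (\<lambda>z. (h z - h p - ereal (inner ?\<xi> (z - p))) / ereal (norm (z - p)))"
    using key by (intro Liminf_mono) (auto simp: eventually_at_filter)
  then show ?thesis using fin unfolding frechet_subdiff_def lim by blast
qed

section \<open>Scalar inequalities, error accumulation and counting\<close>

text \<open>The logarithm lies below all its tangents. The slope \<open>\<delta>\<close> remains
  free so that it can later be chosen small enough for absorption.\<close>

lemma ln_linear_bound:
  fixes u \<delta> :: real
  assumes "u > 0" "\<delta> > 0"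
  shows "ln u \<le> \<delta> * u - ln \<delta>"
proof -
  have "ln (\<delta> * u) \<le> \<delta> * u - 1" using assms by (intro ln_le_minus_one) simp
  then show ?thesis using assms by (simp add: ln_mult)
qed

lemma sum_le_sqrt_card:
  fixes a :: "nat \<Rightarrow> real"
  shows "(\<Sum>t<T. a t) \<le> sqrt (real T) * sqrt (\<Sum>t<T. (a t)\<^sup>2)"
proof -
  have "(\<Sum>t<T. a t) \<le> (\<Sum>t<T. \<bar>1\<bar> * \<bar>a t\<bar>)" by (rule sum_mono) simp
  also have "\<dots> \<le> L2_set (\<lambda>_. 1) {..<T} * L2_set a {..<T}"
    by (rule L2_set_mult_ineq)
  finally show ?thesis by (simp add: L2_set_def)
qed

text \<open>
  An increment \<open>Y s\<close> is carried along for at most \<open>q\<close> steps before the error is reset; the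
  induction keeps track of the \<open>q - 1 - t mod q\<close> copies of \<open>e t\<close> still to come before the
  next reset.
\<close>

lemma spider_sum_bound:
  fixes e Y :: "nat \<Rightarrow> real"
  assumes q: "q \<ge> 1" and e0: "\<And>t. q dvd t \<Longrightarrow> e t = 0" and Y: "\<And>t. Y t \<ge> 0"
    and step: "\<And>t. \<not> q dvd Suc t \<Longrightarrow> e (Suc t) \<le> e t + Y t"
    and nonneg: "\<And>t. e t \<ge> 0"
  shows "(\<Sum>s\<le>t. e s) \<le> real q * (\<Sum>s<t. Y s)"
proof -
  have "(\<Sum>s\<le>t. e s) + real (q - 1 - t mod q) * e t \<le> real q * (\<Sum>s<t. Y s)"
  proof (induction t)
    case 0
    then show ?case using e0[of 0] by simp
  next
    case (Suc t)
    show ?case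
    proof (cases "q dvd Suc t")
      case True
      have "0 \<le> real (q - 1 - t mod q) * e t" "0 \<le> real q * Y t" using nonneg Y by auto
      then show ?thesis using Suc.IH e0[OF True] by (simp add: distrib_left)
    next
      case False
      then have mod: "Suc t mod q = Suc (t mod q)" by (simp add: mod_Suc dvd_eq_mod_eq_0 split: if_splits)
      have lt: "Suc t mod q < q" using q by simp
      have eq: "real (q - 1 - Suc t mod q) = real (q - 1 - t mod q) - 1"
        using lt unfolding mod by linarith
      have "real (q - 1 - t mod q) * e (Suc t) \<le> real (q - 1 - t mod q) * (e t + Y t)"
        using step[OF False] by (rule mult_left_mono) simp
      also have "\<dots> \<le> real (q - 1 - t mod q) * e t + real q * Y t"
        using Y[of t] by (simp add: distrib_left mult_right_mono)
      finally show ?thesis using Suc.IH unfolding eq by (simp add: algebra_simps del: of_nat_diff)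
    qed
  qed
  moreover have "0 \<le> real (q - 1 - t mod q) * e t" using nonneg by simp
  ultimately show ?thesis by linarith
qed

text \<open>Models the cost of a run in which every \<open>q\<close>-th step has the expensive price
  \<open>c1\<close>. The summand \<open>1\<close> pays for the initial multiple
  \<open>t = 0\<close>.\<close>

lemma sum_dvd_le:
  fixes c1 c2 :: real
  assumes q: "q \<ge> 1" and c: "c1 \<ge> 0" "c2 \<ge> 0"
  shows "(\<Sum>t<n. if q dvd t then c1 else c2) \<le> c1 * (real n / real q + 1) + c2 * real n"
proof -
  have card: "real (card {t. t < n \<and> q dvd t}) \<le> real n / real q + 1"
  proof -
    \<comment> \<open>The quotients range over \<open>0\<close> to \<open>n div q\<close>, both
      included, hence one more than \<open>n div q\<close> of them.\<close>
    have "{t. t < n \<and> q dvd t} \<subseteq> (\<lambda>k. q * k) ` {..n div q}"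
      using q by (auto elim!: dvdE simp: less_eq_div_iff_mult_less_eq mult.commute)
    then have "card {t. t < n \<and> q dvd t} \<le> card {..n div q}"
      by (meson card_image_le card_mono finite_atMost finite_imageI le_trans)
    moreover have "real (n div q) \<le> real n / real q" by (rule of_nat_div_le_of_nat)
    ultimately show ?thesis by simp
  qed
  have "(\<Sum>t<n. if q dvd t then c1 else c2) \<le> (\<Sum>t<n. (if q dvd t then c1 else 0) + c2)"
    using c by (intro sum_mono) auto
  also have "\<dots> = c1 * real (card {t. t < n \<and> q dvd t}) + c2 * real n"
    by (simp add: sum.distrib sum.If_cases Int_def)
  also have "\<dots> \<le> c1 * (real n / real q + 1) + c2 * real n"
    using card c by (intro add_right_mono mult_left_mono) auto
  finally show ?thesis .
qed

text \<open>Completing the square backwards: the centre \<open>y - vdiv g w\<close> turns into a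
  linear term in \<open>g\<close>, and the weighted square of \<open>vdiv g w\<close> is the same on
  both sides and cancels.\<close>

lemma prox_vdiv_le:
  assumes p: "p \<in> prox h (y - vdiv g w) w" and pos: "\<And>i. 0 < w $ i"
    and fp: "\<bar>h p\<bar> \<noteq> \<infinity>" and fz: "\<bar>h z\<bar> \<noteq> \<infinity>"
  shows "real_of_ereal (h p) + inner (p - y) g + 1 / 2 * wnorm_sq w (p - y)
       \<le> real_of_ereal (h z) + inner (z - y) g + 1 / 2 * wnorm_sq w (z - y)"
proof -
  have eq: "wnorm_sq w (u - (y - vdiv g w))
      = wnorm_sq w (u - y) + 2 * inner (u - y) g + wnorm_sq w (vdiv g w)" for u
  proof -
    have "inner (w * (u - y)) (vdiv g w) = inner (u - y) g"
      unfolding inner_vec_def using pos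
      by (intro sum.cong) (auto simp: vdiv_def less_imp_neq[symmetric])
    then show ?thesis using wnorm_sq_add[of w "u - y" "vdiv g w"] by (simp add: algebra_simps)
  qed
  show ?thesis using prox_le[OF p, of z] fp fz unfolding eq
    by (cases "h p"; cases "h z") (simp_all add: field_simps)
qed

lemma mult_vdiv_cancel:
  assumes "\<And>i. w $ i \<noteq> 0"
  shows "w * vdiv g w = g"
  using assms by (simp add: vec_eq_iff vdiv_def)

section \<open>The averaged function and the variance of a mini-batch\<close>

context composite_problem
begin

abbreviation fN :: "real ^ 'n \<Rightarrow> real" where "fN \<equiv> favg N f"

text \<open>The sign of \<open>L\<close> follows from the Lipschitz bound at the two distinct points
  \<open>1\<close> and \<open>0\<close>.\<close>

lemma L_nonneg: "0 \<le> L"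
proof -
  have "0 \<le> norm (grad (f 1) 1 - grad (f 1) 0)" by simp
  also have "\<dots> \<le> L * norm (1 :: real ^ 'n)" using L_smooth[of 1 1 0] N_pos by simp
  finally have "0 \<le> L * norm (1 :: real ^ 'n)" .
  moreover have "norm (1 :: real ^ 'n) > 0" by simp
  ultimately show ?thesis by (simp add: zero_le_mult_iff)
qed

lemma gderiv_favg: "GDERIV fN z :> (1 / real N) *\<^sub>R (\<Sum>i\<in>{1..N}. grad (f i) z)"
proof -
  have "((\<lambda>z. (1 / real N) * (\<Sum>i\<in>{1..N}. f i z)) has_derivative
      (\<lambda>u. (1 / real N) * (\<Sum>i\<in>{1..N}. inner u (grad (f i) z)))) (at z)"
    using GDERIV_grad[OF f_differentiable] unfolding gderiv_def
    by (intro has_derivative_mult_right has_derivative_sum) auto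
  then show ?thesis
    unfolding gderiv_def favg_def[abs_def] by (simp add: inner_sum_right)
qed

lemma grad_favg: "grad fN z = (1 / real N) *\<^sub>R (\<Sum>i\<in>{1..N}. grad (f i) z)"
  by (rule grad_eqI) (rule gderiv_favg)

lemma favg_differentiable: "fN differentiable (at z)"
  using gderiv_favg unfolding gderiv_def differentiable_def by blast

lemma grad_favg_lipschitz: "norm (grad fN u - grad fN z) \<le> L * norm (u - z)"
proof -
  have "grad fN u - grad fN z = (1 / real N) *\<^sub>R (\<Sum>i\<in>{1..N}. grad (f i) u - grad (f i) z)"
    by (simp add: grad_favg sum_subtractf scaleR_diff_right)
  then have "norm (grad fN u - grad fN z)
      = (1 / real N) * norm (\<Sum>i\<in>{1..N}. grad (f i) u - grad (f i) z)" by simp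
  also have "\<dots> \<le> (1 / real N) * (\<Sum>i\<in>{1..N}. L * norm (u - z))"
    by (intro mult_left_mono order_trans[OF norm_sum] sum_mono L_smooth) auto
  also have "\<dots> = L * norm (u - z)" using N_pos by simp
  finally show ?thesis .
qed

lemma favg_descent:
  "fN z \<le> fN u + inner (grad fN u) (z - u) + L * (norm (z - u))\<^sup>2"
  by (rule lipschitz_grad_descent[OF favg_differentiable grad_favg_lipschitz L_nonneg])

lemma h_not_MInf: "h z \<noteq> - \<infinity>"
  using h_proper unfolding proper_fun_def by blast

lemma h_finite_iff: "\<bar>h z\<bar> \<noteq> \<infinity> \<longleftrightarrow> z \<in> dom_objective N f h"
  using h_not_MInf[of z] by (cases "h z") (auto simp: dom_objective_def objective_def)

text \<open>The left-hand side is the mean over a uniform batch with everything else frozen. The old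
  error \<open>a - grad fN z\<close> persists as the deterministic part; the centred sampling part
  has variance of order \<open>1 / b\<close>.\<close>

lemma sampling_variance:
  assumes b: "b \<ge> 1"
  shows "(\<Sum>J\<in>PiE {..<b} (\<lambda>_. {1..N}).
       (norm (a + batch_grad f b J u - batch_grad f b J z - grad fN u))\<^sup>2) / real N ^ b
     \<le> (norm (a - grad fN z))\<^sup>2 + L\<^sup>2 / real b * (norm (u - z))\<^sup>2"
proof -
  define D where "D i = grad (f i) u - grad (f i) z" for i
  define m where "m = grad fN u - grad fN z"
  \<comment> \<open>The contribution of one draw: centred by the population mean \<open>m\<close>,
    and scaled so that a batch adds up \<open>b\<close> of them.\<close>
  define w where "w i = (1 / real b) *\<^sub>R (D i - m)" for i
  have N: "real N > 0" using N_pos by simp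
  have sumD: "(\<Sum>i\<in>{1..N}. D i) = real (card {1..N}) *\<^sub>R m"
    using N by (simp add: D_def m_def grad_favg sum_subtractf scaleR_diff_right)
  have zero: "(\<Sum>i\<in>{1..N}. w i) = 0"
    using sumD unfolding w_def scaleR_sum_right[symmetric] sum_subtractf sum_constant_scaleR by simp
  have eq: "a + batch_grad f b J u - batch_grad f b J z - grad fN u
      = (a - grad fN z) + (\<Sum>k<b. w (J k))" for J
  proof -
    have "(\<Sum>k<b. w (J k)) = (1 / real b) *\<^sub>R (\<Sum>k<b. D (J k)) - (1 / real b) *\<^sub>R (real b *\<^sub>R m)"
      unfolding w_def scaleR_diff_right sum_subtractf sum_constant_scaleR by (simp add: scaleR_sum_right)
    also have "(1 / real b) *\<^sub>R (real b *\<^sub>R m) = m" using b by simp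
    also have "(1 / real b) *\<^sub>R (\<Sum>k<b. D (J k)) = batch_grad f b J u - batch_grad f b J z"
      by (simp add: D_def batch_grad_def sum_subtractf scaleR_diff_right)
    finally show ?thesis by (simp add: m_def)
  qed
  have "(\<Sum>i\<in>{1..N}. (norm (D i - m))\<^sup>2) \<le> (\<Sum>i\<in>{1..N}. (norm (D i))\<^sup>2)"
    by (rule sum_norm_sq_centred_le[OF _ _ sumD]) (use N_pos in auto)
  also have "\<dots> \<le> (\<Sum>i\<in>{1..N}. (L * norm (u - z))\<^sup>2)"
    unfolding D_def by (intro sum_mono power_mono L_smooth) auto
  also have "\<dots> = real N * (L\<^sup>2 * (norm (u - z))\<^sup>2)" by (simp add: power_mult_distrib)
  finally have var: "(\<Sum>i\<in>{1..N}. (norm (D i - m))\<^sup>2) \<le> real N * (L\<^sup>2 * (norm (u - z))\<^sup>2)" .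
  have "real b * (\<Sum>i\<in>{1..N}. (norm (w i))\<^sup>2) / real N
      = (\<Sum>i\<in>{1..N}. (norm (D i - m))\<^sup>2) / (real b * real N)"
    using b unfolding w_def
    by (simp add: power_divide sum_divide_distrib[symmetric] power2_eq_square)
  also have "\<dots> \<le> (real N * (L\<^sup>2 * (norm (u - z))\<^sup>2)) / (real b * real N)"
    using var by (intro divide_right_mono) auto
  also have "\<dots> = L\<^sup>2 / real b * (norm (u - z))\<^sup>2" using N by simp
  finally have "real b * (\<Sum>i\<in>{1..N}. (norm (w i))\<^sup>2) / real N \<le> L\<^sup>2 / real b * (norm (u - z))\<^sup>2" .
  moreover have "(\<Sum>J\<in>PiE {..<b} (\<lambda>_. {1..N}). (norm ((a - grad fN z) + (\<Sum>k<b. w (J k))))\<^sup>2)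
      = real N ^ b * ((norm (a - grad fN z))\<^sup>2 + real b * (\<Sum>i\<in>{1..N}. (norm (w i))\<^sup>2) / real N)"
    using sum_norm_sq_sampling[where A = "{1..N}" and w = w and b = b and u = "a - grad fN z"] zero N_pos by simp
  ultimately show ?thesis unfolding eq using N by simp
qed

end

subsection \<open>Pathwise energy estimates\<close>

text \<open>Bounds the factor by which the squared scales can grow in one iteration;
  \<open>4 * xbar\<^sup>2\<close> bounds the squared diameter of the domain.\<close>

definition growth_const :: "real \<Rightarrow> real \<Rightarrow> real \<Rightarrow> real" where
  "growth_const xbar \<alpha> \<beta> = 1 + 4 * xbar\<^sup>2 * (\<alpha> + \<beta>)"

context aepg_spider
begin

text \<open>
  \<open>dp\<close>, \<open>rp\<close>, \<open>sp\<close> and \<open>potp\<close> are the displacement, the scaled displacement, the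
  extrapolation weight and the potential of the preceding iteration.
\<close>

definition dp :: "nat \<Rightarrow> 'w \<Rightarrow> real ^ 'n" where
  "dp t \<omega> = (if t = 0 then 0 else d_seq x (t - 1) \<omega>)"

definition rp :: "nat \<Rightarrow> 'w \<Rightarrow> real ^ 'n" where
  "rp t \<omega> = (if t = 0 then 0 else r_seq x v (t - 1) \<omega>)"

definition sp :: "nat \<Rightarrow> 'w \<Rightarrow> real" where
  "sp t \<omega> = (if t = 0 then \<theta> else sigma (t - 1) \<omega>)"

definition rsum :: "nat \<Rightarrow> 'w \<Rightarrow> real" where
  "rsum t \<omega> = (\<Sum>i<t. (norm (r_seq x v i \<omega>))\<^sup>2)"

text \<open>\<open>vlo\<close> and \<open>vhi\<close> are scalar envelopes of the entries of
  \<open>v t\<close>. The upper one coincides with \<open>V_cal\<close>.\<close>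

definition vlo :: "nat \<Rightarrow> 'w \<Rightarrow> real" where
  "vlo t \<omega> = sqrt (vlow\<^sup>2 + \<alpha> * rsum t \<omega>)"

definition vhi :: "nat \<Rightarrow> 'w \<Rightarrow> real" where
  "vhi t \<omega> = sqrt (vlow\<^sup>2 + (\<alpha> + \<beta>) * rsum t \<omega>)"

definition err :: "nat \<Rightarrow> 'w \<Rightarrow> real" where
  "err t \<omega> = norm (g t \<omega> - grad fN (y t \<omega>))"

definition pot :: "nat \<Rightarrow> 'w \<Rightarrow> real" where
  "pot t \<omega> = 1 / 2 * (1 - sp t \<omega>) * wnorm_sq (v t \<omega>) (d_seq x t \<omega>)"

definition potp :: "nat \<Rightarrow> 'w \<Rightarrow> real" where
  "potp t \<omega> = (if t = 0 then 0 else pot (t - 1) \<omega>)"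

definition Fval :: "nat \<Rightarrow> 'w \<Rightarrow> real" where
  "Fval t \<omega> = fN (x t \<omega>) + real_of_ereal (h (x t \<omega>))"

section \<open>Envelopes of the weights\<close>

lemma rsum_nonneg: "0 \<le> rsum t \<omega>"
  unfolding rsum_def by (intro sum_nonneg) simp

lemma rsum_Suc: "rsum (Suc t) \<omega> = rsum t \<omega> + (norm (r_seq x v t \<omega>))\<^sup>2"
  by (simp add: rsum_def)

lemma V_cal_eq: "V_cal vlow \<alpha> \<beta> x v t \<omega> = vhi t \<omega>"
  using vlow_pos by (cases t) (simp_all add: vhi_def rsum_def R_cal_def lessThan_Suc_atMost)

lemma vlo_sq: "(vlo t \<omega>)\<^sup>2 = vlow\<^sup>2 + \<alpha> * rsum t \<omega>"
  using \<alpha>_pos rsum_nonneg[of t \<omega>] by (simp add: vlo_def)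

lemma vhi_sq: "(vhi t \<omega>)\<^sup>2 = vlow\<^sup>2 + (\<alpha> + \<beta>) * rsum t \<omega>"
  using \<alpha>_pos \<beta>_nonneg rsum_nonneg[of t \<omega>] by (simp add: vhi_def)

lemma vlow_le_vlo: "vlow \<le> vlo t \<omega>"
  unfolding vlo_def using \<alpha>_pos rsum_nonneg[of t \<omega>] by (intro real_le_rsqrt) simp

lemma vlo_le_vhi: "vlo t \<omega> \<le> vhi t \<omega>"
  unfolding vlo_def vhi_def using \<beta>_nonneg rsum_nonneg[of t \<omega>]
  by (simp add: mult_right_mono)

lemma vlo_pos: "0 < vlo t \<omega>"
  using vlow_pos vlow_le_vlo by (rule less_le_trans)

lemma vhi_pos: "0 < vhi t \<omega>"
  using vlo_pos vlo_le_vhi by (rule less_le_trans)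

text \<open>The envelopes are comparable up to a constant depending only on \<alpha> and \<beta>, so
  that bounds involving \<open>vhi\<close> can be returned to \<open>vlo\<close>.\<close>

lemma vhi_le_vlo: "\<alpha> * (vhi t \<omega>)\<^sup>2 \<le> (\<alpha> + \<beta>) * (vlo t \<omega>)\<^sup>2"
  unfolding vlo_sq vhi_sq using \<beta>_nonneg by (simp add: algebra_simps)

lemma s_seq_nth:
  "s_seq \<alpha> \<beta> x v t \<omega> $ i = \<alpha> * (norm (r_seq x v t \<omega>))\<^sup>2 + \<beta> * (r_seq x v t \<omega> $ i)\<^sup>2"
  by (simp add: s_seq_def power2_eq_square)

lemma s_seq_nonneg: "0 \<le> s_seq \<alpha> \<beta> x v t \<omega> $ i"
  unfolding s_seq_nth using \<alpha>_pos \<beta>_nonneg by simp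

lemma v_nth:
  assumes "\<omega> \<in> space M"
  shows "v t \<omega> $ i = sqrt (vlow\<^sup>2 + (\<Sum>j<t. s_seq \<alpha> \<beta> x v j \<omega> $ i))"
proof (cases t)
  case 0
  then show ?thesis using vlow_pos by (simp add: v_init[OF assms])
next
  case (Suc k)
  then show ?thesis
    by (simp add: v_step[OF assms] v_init[OF assms] vsqrt_def power2_eq_square lessThan_Suc_atMost)
qed

lemma vlo_le:
  assumes "\<omega> \<in> space M"
  shows "vlo t \<omega> \<le> v t \<omega> $ i"
  unfolding v_nth[OF assms] vlo_def rsum_def sum_distrib_left s_seq_nth using \<beta>_nonneg
  by (intro real_sqrt_le_mono add_left_mono sum_mono) simp

lemma le_vhi:
  assumes "\<omega> \<in> space M"
  shows "v t \<omega> $ i \<le> vhi t \<omega>"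
  unfolding v_nth[OF assms] vhi_def rsum_def sum_distrib_left
proof (intro real_sqrt_le_mono add_left_mono sum_mono)
  fix j
  have "(r_seq x v j \<omega> $ i)\<^sup>2 \<le> (norm (r_seq x v j \<omega>))\<^sup>2"
    using component_le_norm_cart[of "r_seq x v j \<omega>" i] power_mono[of "\<bar>r_seq x v j \<omega> $ i\<bar>" _ 2] by simp
  then show "s_seq \<alpha> \<beta> x v j \<omega> $ i \<le> (\<alpha> + \<beta>) * (norm (r_seq x v j \<omega>))\<^sup>2"
    unfolding s_seq_nth using \<beta>_nonneg by (simp add: algebra_simps mult_left_mono)
qed

lemma v_pos: "\<omega> \<in> space M \<Longrightarrow> 0 < v t \<omega> $ i"
  using vlo_pos vlo_le by (rule less_le_trans)

lemma v_mono:
  assumes "\<omega> \<in> space M"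
  shows "v t \<omega> $ i \<le> v (Suc t) \<omega> $ i"
  unfolding v_nth[OF assms] using s_seq_nonneg by (intro real_sqrt_le_mono) simp

section \<open>Extrapolation weights and boundedness of the iterates\<close>

lemma y_eq:
  assumes "\<omega> \<in> space M"
  shows "y t \<omega> = x t \<omega> + sp t \<omega> *\<^sub>R dp t \<omega>"
  by (cases t) (simp_all add: x_init[OF assms] y_init[OF assms] y_step[OF assms] sp_def dp_def)

lemma sp_Suc:
  assumes "\<omega> \<in> space M"
  shows "sp (Suc t) \<omega> = \<theta> * (1 - sp t \<omega>) * vmin (vdiv (v t \<omega>) (v (Suc t) \<omega>))"
  using sigma_step[OF assms, of t] by (simp add: sp_def)

text \<open>The minimal ratio is attained in some coordinate and lies between \<open>0\<close> and
  \<open>1\<close> there because \<open>v\<close> is nondecreasing in time. As \<theta> is less than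
  \<open>1\<close>, the factor \<open>1 - sp t\<close> stays away from zero.\<close>

lemma sp_range:
  assumes \<omega>: "\<omega> \<in> space M"
  shows "0 \<le> sp t \<omega> \<and> sp t \<omega> \<le> \<theta>"
proof (induction t)
  case 0
  then show ?case using \<theta>_range by (simp add: sp_def)
next
  case (Suc t)
  obtain i where i: "vmin (vdiv (v t \<omega>) (v (Suc t) \<omega>)) = v t \<omega> $ i / v (Suc t) \<omega> $ i"
    using vmin_attained[of "vdiv (v t \<omega>) (v (Suc t) \<omega>)"] by (auto simp: vdiv_def)
  let ?m = "v t \<omega> $ i / v (Suc t) \<omega> $ i"
  have m: "0 \<le> ?m" "?m \<le> 1" using v_pos[OF \<omega>, of t i] v_pos[OF \<omega>, of "Suc t" i] v_mono[OF \<omega>, of t i]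
    by (auto simp: less_imp_le)
  have s: "0 \<le> 1 - sp t \<omega>" "1 - sp t \<omega> \<le> 1" using Suc.IH \<theta>_range by auto
  have "\<theta> * (1 - sp t \<omega>) * ?m \<le> \<theta> * 1 * 1"
    using m s \<theta>_range by (intro mult_mono) auto
  moreover have "0 \<le> \<theta> * (1 - sp t \<omega>) * ?m"
    by (intro mult_nonneg_nonneg m s \<theta>_range)
  ultimately show ?case unfolding sp_Suc[OF \<omega>] i by simp
qed

lemma sp_le_one: "\<omega> \<in> space M \<Longrightarrow> sp t \<omega> \<le> 1"
  using sp_range[of \<omega> t] \<theta>_range by linarith

text \<open>The minimum over coordinates in the definition of \<open>sigma\<close> is exactly what
  makes this hold in every coordinate at once.\<close>

lemma sp_v_le:
  assumes \<omega>: "\<omega> \<in> space M"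
  shows "sp (Suc t) \<omega> * v (Suc t) \<omega> $ i \<le> \<theta> * (1 - sp t \<omega>) * v t \<omega> $ i"
proof -
  have "vmin (vdiv (v t \<omega>) (v (Suc t) \<omega>)) * v (Suc t) \<omega> $ i \<le> v t \<omega> $ i"
    using vmin_le[of "vdiv (v t \<omega>) (v (Suc t) \<omega>)" i] v_pos[OF \<omega>, of "Suc t" i]
    by (simp add: vdiv_def pos_le_divide_eq)
  moreover have "0 \<le> \<theta> * (1 - sp t \<omega>)" using \<theta>_range sp_le_one[OF \<omega>, of t] by simp
  ultimately show ?thesis unfolding sp_Suc[OF \<omega>] mult.assoc[of "\<theta> * (1 - sp t \<omega>)"]
    by (rule mult_left_mono)
qed

text \<open>A proximal minimiser does at least as well as \<open>x0\<close>, where \<open>h\<close>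
  is finite.\<close>

lemma x_in_dom:
  assumes \<omega>: "\<omega> \<in> space M"
  shows "x t \<omega> \<in> dom_objective N f h"
proof (cases t)
  case 0
  then show ?thesis using x_init[OF \<omega>] x0_dom by simp
next
  case (Suc k)
  have "h x0 < \<infinity>" using x0_dom h_finite_iff[of x0] by (cases "h x0") auto
  then have "\<bar>h (x (Suc k) \<omega>)\<bar> \<noteq> \<infinity>" by (rule prox_finite[OF x_step[OF \<omega>] _ h_not_MInf])
  then show ?thesis using Suc h_finite_iff by simp
qed

lemma h_x_finite: "\<omega> \<in> space M \<Longrightarrow> \<bar>h (x t \<omega>)\<bar> \<noteq> \<infinity>"
  by (simp add: x_in_dom h_finite_iff)

lemma norm_x_le: "\<omega> \<in> space M \<Longrightarrow> norm (x t \<omega>) \<le> xbar"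
  using x_in_dom dom_bounded by blast

lemma norm_d_le: "\<omega> \<in> space M \<Longrightarrow> norm (d_seq x t \<omega>) \<le> 2 * xbar"
  unfolding d_seq_def
  using norm_triangle_ineq4[of "x (Suc t) \<omega>" "x t \<omega>"] norm_x_le[of \<omega> t] norm_x_le[of \<omega> "Suc t"]
  by linarith

lemma norm_dp_le: "\<omega> \<in> space M \<Longrightarrow> norm (dp t \<omega>) \<le> 2 * xbar"
  using norm_d_le xbar_pos by (simp add: dp_def)

lemma norm_sp_dp_le: "\<omega> \<in> space M \<Longrightarrow> norm (sp t \<omega> *\<^sub>R dp t \<omega>) \<le> norm (dp t \<omega>)"
  using sp_range[of \<omega> t] sp_le_one[of \<omega> t] by (simp add: mult_left_le_one_le)

lemma norm_r_ge: "\<omega> \<in> space M \<Longrightarrow> vlo t \<omega> * norm (d_seq x t \<omega>) \<le> norm (r_seq x v t \<omega>)"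
  unfolding r_seq_def using vlo_pos[of t \<omega>] vlo_le by (intro norm_mult_ge) auto

lemma norm_r_le: "\<omega> \<in> space M \<Longrightarrow> norm (r_seq x v t \<omega>) \<le> vhi t \<omega> * norm (d_seq x t \<omega>)"
  unfolding r_seq_def using v_pos le_vhi by (intro norm_mult_le) (simp add: abs_of_pos)

lemma pot_nonneg: "\<omega> \<in> space M \<Longrightarrow> 0 \<le> pot t \<omega>"
  unfolding pot_def using sp_le_one[of \<omega> t] v_pos[of \<omega> t]
  by (intro mult_nonneg_nonneg wnorm_sq_nonneg) (auto simp: less_imp_le)

text \<open>Moves the preceding displacement from the weight \<open>v t\<close> to its own weight
  \<open>v (t - 1)\<close>, so that the momentum term is paid for by the fraction \<theta> of the
  preceding potential.\<close>

lemma sp_wnorm_dp_le: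
  assumes \<omega>: "\<omega> \<in> space M"
  shows "sp t \<omega> * wnorm_sq (v t \<omega>) (dp t \<omega>) \<le> 2 * \<theta> * potp t \<omega>"
proof (cases t)
  case 0
  then show ?thesis by (simp add: dp_def potp_def wnorm_sq_def)
next
  case (Suc k)
  have "sp t \<omega> * wnorm_sq (v t \<omega>) (dp t \<omega>)
      = (\<Sum>i\<in>UNIV. (d_seq x k \<omega> $ i)\<^sup>2 * (sp (Suc k) \<omega> * v (Suc k) \<omega> $ i))"
    using Suc by (simp add: dp_def wnorm_sq_def sum_distrib_left mult_ac)
  also have "\<dots> \<le> (\<Sum>i\<in>UNIV. (d_seq x k \<omega> $ i)\<^sup>2 * (\<theta> * (1 - sp k \<omega>) * v k \<omega> $ i))"
    by (intro sum_mono mult_left_mono sp_v_le[OF \<omega>]) auto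
  also have "\<dots> = 2 * \<theta> * potp t \<omega>"
    using Suc by (simp add: potp_def pot_def wnorm_sq_def sum_distrib_left mult_ac)
  finally show ?thesis .
qed

text \<open>The same change of weights in the Euclidean norm: \<open>sp t * v t\<close> is at most
  \<open>v (t - 1)\<close> in each coordinate. It serves the estimate of the residual.\<close>

lemma norm_sp_v_dp_le:
  assumes \<omega>: "\<omega> \<in> space M"
  shows "norm (v t \<omega> * (sp t \<omega> *\<^sub>R dp t \<omega>)) \<le> norm (rp t \<omega>)"
proof (cases t)
  case 0
  then show ?thesis by (simp add: dp_def)
next
  case (Suc k)
  have "(norm (v t \<omega> * (sp t \<omega> *\<^sub>R dp t \<omega>)))\<^sup>2 \<le> (norm (rp t \<omega>))\<^sup>2"
    unfolding norm_sq_vec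
  proof (rule sum_mono)
    fix i
    have "0 \<le> sp t \<omega> * v t \<omega> $ i" using sp_range[OF \<omega>, of t] v_pos[OF \<omega>, of t i] by simp
    moreover have "sp t \<omega> * v t \<omega> $ i \<le> v k \<omega> $ i"
    proof -
      have "\<theta> * (1 - sp k \<omega>) \<le> 1 * 1"
        using \<theta>_range sp_range[OF \<omega>, of k] sp_le_one[OF \<omega>, of k] by (intro mult_mono) auto
      then have "\<theta> * (1 - sp k \<omega>) * v k \<omega> $ i \<le> v k \<omega> $ i"
        using v_pos[OF \<omega>, of k i] by (simp add: mult_le_cancel_right1)
      then show ?thesis using sp_v_le[OF \<omega>, of k i] Suc by simp
    qed
    ultimately have "(sp t \<omega> * v t \<omega> $ i)\<^sup>2 \<le> (v k \<omega> $ i)\<^sup>2" by (intro power_mono)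
    then have "(sp t \<omega> * v t \<omega> $ i)\<^sup>2 * (d_seq x k \<omega> $ i)\<^sup>2 \<le> (v k \<omega> $ i)\<^sup>2 * (d_seq x k \<omega> $ i)\<^sup>2"
      by (rule mult_right_mono) simp
    then show "((v t \<omega> * (sp t \<omega> *\<^sub>R dp t \<omega>)) $ i)\<^sup>2 \<le> (rp t \<omega> $ i)\<^sup>2"
      using Suc by (simp add: dp_def rp_def r_seq_def power_mult_distrib mult_ac)
  qed
  then show ?thesis by (simp add: power2_le_iff_abs_le)
qed

section \<open>Descent of the potential\<close>

text \<open>The proximal point is compared with \<open>x t\<close>, and the smooth part is expanded
  at \<open>x t\<close> instead of \<open>y t\<close>. The momentum then enters only through the
  cross term of the weighted squares, which Young's inequality splits between \<open>pot t\<close>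
  and \<open>potp t\<close>.\<close>

lemma objective_step:
  assumes \<omega>: "\<omega> \<in> space M"
  shows "Fval (Suc t) \<omega> + pot t \<omega>
     \<le> Fval t \<omega> + \<theta> * potp t \<omega> + inner (grad fN (x t \<omega>) - g t \<omega>) (d_seq x t \<omega>)
        + L * (norm (d_seq x t \<omega>))\<^sup>2"
proof -
  let ?w = "v t \<omega>" and ?d = "d_seq x t \<omega>" and ?dp = "dp t \<omega>" and ?s = "sp t \<omega>"
  have py: "x (Suc t) \<omega> - y t \<omega> = ?d + (- ?s) *\<^sub>R ?dp"
    and zy: "x t \<omega> - y t \<omega> = (- ?s) *\<^sub>R ?dp"
    by (simp_all add: y_eq[OF \<omega>] d_seq_def)
  have add: "wnorm_sq ?w (x (Suc t) \<omega> - y t \<omega>) = wnorm_sq ?w ?d - 2 * ?s * inner (?w * ?d) ?dp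
      + wnorm_sq ?w (x t \<omega> - y t \<omega>)"
    unfolding py zy wnorm_sq_add by (simp add: algebra_simps)
  have "?s * (2 * inner (?w * ?d) ?dp) \<le> ?s * (wnorm_sq ?w ?d + wnorm_sq ?w ?dp)"
    using sp_range[OF \<omega>, of t] v_pos[OF \<omega>, of t]
    by (intro mult_left_mono inner_weighted_le) (auto simp: less_imp_le)
  also have "\<dots> \<le> ?s * wnorm_sq ?w ?d + 2 * \<theta> * potp t \<omega>"
    using sp_wnorm_dp_le[OF \<omega>, of t] by (simp add: distrib_left)
  finally have cross: "2 * ?s * inner (?w * ?d) ?dp \<le> ?s * wnorm_sq ?w ?d + 2 * \<theta> * potp t \<omega>"
    by (simp add: mult_ac)
  have "real_of_ereal (h (x (Suc t) \<omega>)) + inner (x (Suc t) \<omega> - y t \<omega>) (g t \<omega>)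
        + 1 / 2 * wnorm_sq ?w (x (Suc t) \<omega> - y t \<omega>)
      \<le> real_of_ereal (h (x t \<omega>)) + inner (x t \<omega> - y t \<omega>) (g t \<omega>)
        + 1 / 2 * wnorm_sq ?w (x t \<omega> - y t \<omega>)"
    by (rule prox_vdiv_le[OF x_step[OF \<omega>] v_pos[OF \<omega>] h_x_finite[OF \<omega>] h_x_finite[OF \<omega>]])
  moreover have "inner (x (Suc t) \<omega> - y t \<omega>) (g t \<omega>) = inner (x t \<omega> - y t \<omega>) (g t \<omega>) + inner (g t \<omega>) ?d"
    by (simp add: d_seq_def inner_diff_left inner_diff_right inner_commute)
  ultimately have hstep: "real_of_ereal (h (x (Suc t) \<omega>)) + inner (g t \<omega>) ?d + pot t \<omega>
      \<le> real_of_ereal (h (x t \<omega>)) + \<theta> * potp t \<omega>"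
    using add cross unfolding pot_def by (simp add: algebra_simps)
  have "fN (x (Suc t) \<omega>) \<le> fN (x t \<omega>) + inner (grad fN (x t \<omega>)) ?d + L * (norm ?d)\<^sup>2"
    unfolding d_seq_def by (rule favg_descent)
  with hstep show ?thesis unfolding Fval_def by (simp add: inner_diff_left)
qed

text \<open>The mismatch between \<open>grad fN (x t)\<close> and \<open>g t\<close> consists of the
  Lipschitz change from \<open>x t\<close> to \<open>y t\<close>, at most
  \<open>L * norm (dp t)\<close>, and the estimator error; each product with the displacement is
  split into squares.\<close>

lemma objective_step_err:
  assumes \<omega>: "\<omega> \<in> space M"
  shows "Fval (Suc t) \<omega> + pot t \<omega>
     \<le> Fval t \<omega> + \<theta> * potp t \<omega> + 1 / 2 * (err t \<omega>)\<^sup>2 + L / 2 * (norm (dp t \<omega>))\<^sup>2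
        + (1 / 2 + 3 / 2 * L) * (norm (d_seq x t \<omega>))\<^sup>2"
proof -
  let ?d = "norm (d_seq x t \<omega>)" and ?p = "norm (dp t \<omega>)" and ?e = "err t \<omega>"
  have "norm (grad fN (x t \<omega>) - g t \<omega>)
      \<le> norm (grad fN (x t \<omega>) - grad fN (y t \<omega>)) + norm (g t \<omega> - grad fN (y t \<omega>))"
    using norm_triangle_ineq4[of "grad fN (x t \<omega>) - grad fN (y t \<omega>)" "g t \<omega> - grad fN (y t \<omega>)"]
    by simp
  also have "norm (grad fN (x t \<omega>) - grad fN (y t \<omega>)) \<le> L * norm (x t \<omega> - y t \<omega>)"
    by (rule grad_favg_lipschitz)
  also have "\<dots> \<le> L * ?p"
    using norm_sp_dp_le[OF \<omega>, of t] L_nonneg by (intro mult_left_mono) (auto simp: y_eq[OF \<omega>])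
  finally have n: "norm (grad fN (x t \<omega>) - g t \<omega>) \<le> L * ?p + ?e" by (simp add: err_def)
  have "inner (grad fN (x t \<omega>) - g t \<omega>) (d_seq x t \<omega>) \<le> norm (grad fN (x t \<omega>) - g t \<omega>) * ?d"
    by (rule norm_cauchy_schwarz)
  also have "\<dots> \<le> (L * ?p + ?e) * ?d" using n by (rule mult_right_mono) simp
  also have "\<dots> = L * (?p * ?d) + ?e * ?d" by (simp add: algebra_simps)
  also have "?p * ?d \<le> (?p\<^sup>2 + ?d\<^sup>2) / 2" using sum_squares_bound[of ?p ?d] by simp
  also have "?e * ?d \<le> (?e\<^sup>2 + ?d\<^sup>2) / 2" using sum_squares_bound[of ?e ?d] by simp
  finally have "inner (grad fN (x t \<omega>) - g t \<omega>) (d_seq x t \<omega>)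
      \<le> L * ((?p\<^sup>2 + ?d\<^sup>2) / 2) + (?e\<^sup>2 + ?d\<^sup>2) / 2" using L_nonneg by (simp add: mult_left_mono)
  then show ?thesis using objective_step[OF \<omega>, of t] by (simp add: field_simps)
qed

text \<open>The terms \<open>\<theta> * potp T\<close> and \<open>L / 2\<close> times the square of
  \<open>dp T\<close> on the left are carried along to pay for the terms of the next step that look
  back. The latter raises \<open>3 / 2 * L\<close> to \<open>2 * L\<close>.\<close>

lemma potential_sum:
  assumes \<omega>: "\<omega> \<in> space M"
  shows "Fval T \<omega> + (1 - \<theta>) * (\<Sum>t<T. pot t \<omega>) + \<theta> * potp T \<omega> + L / 2 * (norm (dp T \<omega>))\<^sup>2
     \<le> Fval 0 \<omega> + 1 / 2 * (\<Sum>t<T. (err t \<omega>)\<^sup>2) + (1 / 2 + 2 * L) * (\<Sum>t<T. (norm (d_seq x t \<omega>))\<^sup>2)"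
proof (induction T)
  case 0
  then show ?case by (simp add: potp_def dp_def)
next
  case (Suc T)
  have "potp (Suc T) \<omega> = pot T \<omega>" "dp (Suc T) \<omega> = d_seq x T \<omega>" by (simp_all add: potp_def dp_def)
  then show ?case using Suc.IH objective_step_err[OF \<omega>, of T] by (simp add: algebra_simps)
qed

text \<open>Convexity of the square gives
  \<open>2 * V * (V' - V) \<le> V'\<^sup>2 - V\<^sup>2\<close>, and the right-hand side is at most a
  multiple of \<open>V\<close> times the weighted square of the displacement. Dividing by
  \<open>V\<close> leaves an increment of \<open>vhi\<close> that is linear in the
  potential.\<close>

lemma vhi_increment:
  assumes \<omega>: "\<omega> \<in> space M"
  shows "(1 - \<theta>) / (\<alpha> + \<beta>) * (vhi (Suc t) \<omega> - vhi t \<omega>) \<le> pot t \<omega>"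
proof -
  let ?V = "vhi t \<omega>" and ?V' = "vhi (Suc t) \<omega>" and ?r = "(norm (r_seq x v t \<omega>))\<^sup>2"
  have ab: "\<alpha> + \<beta> > 0" using \<alpha>_pos \<beta>_nonneg by simp
  have diff: "?V'\<^sup>2 - ?V\<^sup>2 = (\<alpha> + \<beta>) * ?r" unfolding vhi_sq rsum_Suc by (simp add: algebra_simps)
  have "0 \<le> (?V' - ?V)\<^sup>2" by simp
  then have "2 * ?V * (?V' - ?V) \<le> ?V'\<^sup>2 - ?V\<^sup>2" by (simp add: power2_eq_square algebra_simps)
  then have 1: "2 * ?V * (?V' - ?V) \<le> (\<alpha> + \<beta>) * ?r" using diff by simp
  have "?r \<le> ?V * wnorm_sq (v t \<omega>) (d_seq x t \<omega>)"
    unfolding r_seq_def using v_pos[OF \<omega>] le_vhi[OF \<omega>]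
    by (intro wnorm_sq_mult_ge) (auto simp: less_imp_le)
  then have "(\<alpha> + \<beta>) * ?r \<le> (\<alpha> + \<beta>) * (?V * wnorm_sq (v t \<omega>) (d_seq x t \<omega>))"
    using ab by (intro mult_left_mono) auto
  with 1 have "2 * ?V * (?V' - ?V) \<le> (\<alpha> + \<beta>) * (?V * wnorm_sq (v t \<omega>) (d_seq x t \<omega>))"
    by (rule order_trans)
  then have "?V * (2 * (?V' - ?V)) \<le> ?V * ((\<alpha> + \<beta>) * wnorm_sq (v t \<omega>) (d_seq x t \<omega>))"
    by (simp only: mult_ac)
  then have 2: "2 * (?V' - ?V) \<le> (\<alpha> + \<beta>) * wnorm_sq (v t \<omega>) (d_seq x t \<omega>)"
    using vhi_pos[of t \<omega>] by simp
  then have "(?V' - ?V) / (\<alpha> + \<beta>) \<le> 1 / 2 * wnorm_sq (v t \<omega>) (d_seq x t \<omega>)"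
    using ab by (simp add: pos_divide_le_eq mult_ac)
  then have "(1 - \<theta>) * ((?V' - ?V) / (\<alpha> + \<beta>)) \<le> (1 - \<theta>) * (1 / 2 * wnorm_sq (v t \<omega>) (d_seq x t \<omega>))"
    using \<theta>_range by (intro mult_left_mono) auto
  also have "\<dots> \<le> (1 - sp t \<omega>) * (1 / 2 * wnorm_sq (v t \<omega>) (d_seq x t \<omega>))"
    using sp_range[OF \<omega>, of t] v_pos[OF \<omega>]
    by (intro mult_right_mono mult_nonneg_nonneg wnorm_sq_nonneg) (auto simp: less_imp_le)
  finally show ?thesis by (simp add: pot_def mult_ac)
qed

lemma vhi_sum_bound:
  assumes \<omega>: "\<omega> \<in> space M"
  shows "(1 - \<theta>) / (\<alpha> + \<beta>) * (vhi T \<omega> - vlow) \<le> (\<Sum>t<T. pot t \<omega>)"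
proof -
  have "vhi 0 \<omega> = vlow" using vlow_pos by (simp add: vhi_def rsum_def)
  then have "vhi T \<omega> - vlow = (\<Sum>t<T. vhi (Suc t) \<omega> - vhi t \<omega>)"
    using sum_lessThan_telescope[of "\<lambda>t. vhi t \<omega>" T] by simp
  then show ?thesis
    using vhi_increment[OF \<omega>] by (auto simp only: sum_distrib_left intro!: sum_mono)
qed

lemma Fval_gap:
  assumes \<omega>: "\<omega> \<in> space M"
    and gap: "objective N f h x0 - (INF z. objective N f h z) = ereal gap"
  shows "Fval 0 \<omega> - Fval T \<omega> \<le> gap"
proof -
  have ob: "objective N f h (x t \<omega>) = ereal (Fval t \<omega>)" for t
    using h_x_finite[OF \<omega>, of t]
    by (cases "h (x t \<omega>)") (auto simp: objective_def Fval_def)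
  have "(INF z. objective N f h z) \<le> ereal (Fval T \<omega>)" unfolding ob[symmetric] by (rule INF_lower) simp
  then show ?thesis using gap ob[of 0] x_init[OF \<omega>]
    by (cases "INF z. objective N f h z") auto
qed

text \<open>One factor \<open>1 - \<theta>\<close> is the part of the potential surviving the
  momentum, the other the lower bound of \<open>1 - sp t\<close> inside the potential.\<close>

lemma energy_bound:
  assumes \<omega>: "\<omega> \<in> space M"
    and gap: "objective N f h x0 - (INF z. objective N f h z) = ereal gap"
  shows "(1 - \<theta>)\<^sup>2 / (\<alpha> + \<beta>) * (vhi T \<omega> - vlow)
     \<le> gap + 1 / 2 * (\<Sum>t<T. (err t \<omega>)\<^sup>2) + (1 / 2 + 2 * L) * (\<Sum>t<T. (norm (d_seq x t \<omega>))\<^sup>2)"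
proof -
  have "(1 - \<theta>) * ((1 - \<theta>) / (\<alpha> + \<beta>) * (vhi T \<omega> - vlow)) \<le> (1 - \<theta>) * (\<Sum>t<T. pot t \<omega>)"
    using vhi_sum_bound[OF \<omega>] \<theta>_range by (intro mult_left_mono) auto
  moreover have "0 \<le> \<theta> * potp T \<omega>" using \<theta>_range pot_nonneg[OF \<omega>] by (simp add: potp_def)
  moreover have "0 \<le> L / 2 * (norm (dp T \<omega>))\<^sup>2" using L_nonneg by simp
  ultimately show ?thesis using potential_sum[OF \<omega>, of T] Fval_gap[OF \<omega> gap, of T]
    by (simp add: power2_eq_square)
qed

section \<open>Growth of the scales and the logarithmic bound on displacements\<close>

abbreviation growth :: real where "growth \<equiv> growth_const xbar \<alpha> \<beta>"

lemma growth_ge_1: "1 \<le> growth"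
  unfolding growth_const_def using \<alpha>_pos \<beta>_nonneg by simp

lemma vlo_growth:
  assumes \<omega>: "\<omega> \<in> space M"
  shows "(vlo (Suc t) \<omega>)\<^sup>2 \<le> growth * (vlo t \<omega>)\<^sup>2"
proof -
  have "(norm (r_seq x v t \<omega>))\<^sup>2 \<le> (vhi t \<omega> * (2 * xbar))\<^sup>2"
    using norm_r_le[OF \<omega>, of t] norm_d_le[OF \<omega>, of t] vhi_pos[of t \<omega>]
    by (intro power_mono order_trans[OF norm_r_le[OF \<omega>]] mult_left_mono) auto
  then have "\<alpha> * (norm (r_seq x v t \<omega>))\<^sup>2 \<le> \<alpha> * (vhi t \<omega> * (2 * xbar))\<^sup>2"
    using \<alpha>_pos by (intro mult_left_mono) auto
  also have "\<dots> = 4 * xbar\<^sup>2 * (\<alpha> * (vhi t \<omega>)\<^sup>2)" by (simp add: power_mult_distrib)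
  also have "\<dots> \<le> 4 * xbar\<^sup>2 * ((\<alpha> + \<beta>) * (vlo t \<omega>)\<^sup>2)"
    using vhi_le_vlo by (intro mult_left_mono) auto
  finally show ?thesis
    unfolding growth_const_def vlo_sq rsum_Suc by (simp add: algebra_simps)
qed

lemma vhi_growth:
  assumes \<omega>: "\<omega> \<in> space M"
  shows "vhi (Suc t) \<omega> \<le> growth * vhi t \<omega>"
proof -
  have "(norm (r_seq x v t \<omega>))\<^sup>2 \<le> (vhi t \<omega> * (2 * xbar))\<^sup>2"
    using norm_d_le[OF \<omega>, of t] vhi_pos[of t \<omega>]
    by (intro power_mono order_trans[OF norm_r_le[OF \<omega>]] mult_left_mono) auto
  then have "(\<alpha> + \<beta>) * (norm (r_seq x v t \<omega>))\<^sup>2 \<le> (\<alpha> + \<beta>) * (vhi t \<omega> * (2 * xbar))\<^sup>2"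
    using \<alpha>_pos \<beta>_nonneg by (intro mult_left_mono) auto
  then have "(vhi (Suc t) \<omega>)\<^sup>2 \<le> growth * (vhi t \<omega>)\<^sup>2"
    unfolding growth_const_def vhi_sq[of "Suc t"] rsum_Suc
    using vhi_sq[of t \<omega>] by (simp add: algebra_simps power_mult_distrib)
  also have "\<dots> \<le> (growth * vhi t \<omega>)\<^sup>2"
    using growth_ge_1 unfolding power_mult_distrib by (intro mult_right_mono self_le_power) auto
  finally have "(vhi (Suc t) \<omega>)\<^sup>2 \<le> (growth * vhi t \<omega>)\<^sup>2" .
  moreover have "0 \<le> growth * vhi t \<omega>"
    using vhi_pos[of t \<omega>] growth_ge_1 by (intro mult_nonneg_nonneg) linarith+
  ultimately show ?thesis by (rule power2_le_imp_le)
qed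

text \<open>A bound depending on \<open>t\<close>, exponential in it; it serves only to make the
  processes integrable.\<close>

lemma vhi_bounded: "\<omega> \<in> space M \<Longrightarrow> vhi t \<omega> \<le> growth ^ t * vlow"
proof (induction t)
  case 0
  then show ?case using vlow_pos by (simp add: vhi_def rsum_def)
next
  case (Suc t)
  have "growth * vhi t \<omega> \<le> growth * (growth ^ t * vlow)"
    using Suc growth_ge_1 by (intro mult_left_mono) auto
  then show ?case using vhi_growth[OF Suc.prems, of t] by (simp add: mult_ac)
qed

text \<open>
  Since the iterates are bounded, \<open>vlo\<close> grows at most geometrically, so a summand is comparable
  to the increment of the logarithm.
\<close>

lemma norm_d_sq_le:
  assumes \<omega>: "\<omega> \<in> space M"
  shows "(norm (d_seq x t \<omega>))\<^sup>2
     \<le> growth / \<alpha> * (ln ((vlo (Suc t) \<omega>)\<^sup>2) - ln ((vlo t \<omega>)\<^sup>2))"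
proof -
  let ?m = "(vlo t \<omega>)\<^sup>2" and ?m' = "(vlo (Suc t) \<omega>)\<^sup>2" and ?d = "(norm (d_seq x t \<omega>))\<^sup>2"
  have m: "?m > 0" "?m' > 0" using vlo_pos[of t \<omega>] vlo_pos[of "Suc t" \<omega>] by simp_all
  have eq: "?m' - ?m = \<alpha> * (norm (r_seq x v t \<omega>))\<^sup>2"
    unfolding vlo_sq rsum_Suc by (simp add: algebra_simps)
  have "?m * ?d \<le> (norm (r_seq x v t \<omega>))\<^sup>2"
    using norm_r_ge[OF \<omega>, of t] vlo_pos[of t \<omega>]
    by (simp add: power_mult_distrib[symmetric] power_mono)
  then have "\<alpha> * (?m * ?d) \<le> ?m' - ?m" unfolding eq using \<alpha>_pos by (intro mult_left_mono) auto
  then have 1: "\<alpha> * ?d \<le> (?m' - ?m) / ?m" using m by (simp add: pos_le_divide_eq mult_ac)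
  have "ln (?m / ?m') \<le> ?m / ?m' - 1" using m by (intro ln_le_minus_one) simp
  then have 2: "(?m' - ?m) / ?m' \<le> ln ?m' - ln ?m"
    using m by (simp add: ln_div diff_divide_distrib)
  have "0 \<le> ?m' - ?m" unfolding eq using \<alpha>_pos by simp
  \<comment> \<open>Exchanging the old value for the new one in the denominator costs the factor
    \<open>growth\<close>; relative to the new value, the increment is below that of the
    logarithm.\<close>
  then have "(?m' - ?m) * ?m' \<le> (?m' - ?m) * (growth * ?m)"
    using vlo_growth[OF \<omega>] by (intro mult_left_mono)
  then have "(?m' - ?m) / ?m \<le> growth * ((?m' - ?m) / ?m')"
    using m by (simp add: field_simps)
  also have "\<dots> \<le> growth * (ln ?m' - ln ?m)" using 2 growth_ge_1 by (intro mult_left_mono) auto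
  finally have "\<alpha> * ?d \<le> growth * (ln ?m' - ln ?m)" using 1 by linarith
  then show ?thesis using \<alpha>_pos by (simp add: pos_le_divide_eq mult_ac)
qed

text \<open>The increments of the logarithm telescope, and \<open>vlo\<close> may be replaced by the
  larger \<open>vhi\<close> at the end.\<close>

lemma sum_norm_d_sq_le:
  assumes \<omega>: "\<omega> \<in> space M"
  shows "(\<Sum>t<T. (norm (d_seq x t \<omega>))\<^sup>2) \<le> 2 * growth / \<alpha> * ln (vhi T \<omega> / vlow)"
proof -
  have "(\<Sum>t<T. (norm (d_seq x t \<omega>))\<^sup>2)
      \<le> (\<Sum>t<T. growth / \<alpha> * (ln ((vlo (Suc t) \<omega>)\<^sup>2) - ln ((vlo t \<omega>)\<^sup>2)))"
    by (rule sum_mono) (rule norm_d_sq_le[OF \<omega>])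
  also have "\<dots> = growth / \<alpha> * (ln ((vlo T \<omega>)\<^sup>2) - ln ((vlo 0 \<omega>)\<^sup>2))"
    using sum_lessThan_telescope[of "\<lambda>t. ln ((vlo t \<omega>)\<^sup>2)" T] by (simp only: sum_distrib_left[symmetric])
  also have "vlo 0 \<omega> = vlow" using vlow_pos by (simp add: vlo_def rsum_def)
  also have "ln ((vlo T \<omega>)\<^sup>2) - ln (vlow\<^sup>2) = 2 * ln (vlo T \<omega> / vlow)"
    using vlow_pos vlo_pos[of T \<omega>] by (simp add: ln_div ln_realpow)
  also have "growth / \<alpha> * (2 * ln (vlo T \<omega> / vlow)) \<le> growth / \<alpha> * (2 * ln (vhi T \<omega> / vlow))"
    using vlow_pos vlo_pos[of T \<omega>] vhi_pos[of T \<omega>] vlo_le_vhi[of T \<omega>] growth_ge_1 \<alpha>_pos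
    by (intro mult_left_mono) (auto intro: divide_right_mono)
  finally show ?thesis by (simp add: mult_ac)
qed

section \<open>The criticality residual\<close>

text \<open>A pathwise majorant of the residual at \<open>x (Suc t)\<close>. It is integrable, so
  all expectations are computed for it and then transferred to \<open>crit_residual\<close> by
  monotonicity.\<close>

definition resid_bound :: "nat \<Rightarrow> 'w \<Rightarrow> real" where
  "resid_bound t \<omega> = err t \<omega> + L * norm (d_seq x t \<omega>) + L * norm (dp t \<omega>)
      + norm (r_seq x v t \<omega>) + norm (rp t \<omega>)"

lemma resid_bound_nonneg: "0 \<le> resid_bound t \<omega>"
  unfolding resid_bound_def err_def using L_nonneg by simp

text \<open>Fermat's rule for the proximal step provides the subgradient.\<close>

lemma crit_residual_le:
  assumes \<omega>: "\<omega> \<in> space M"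
  shows "crit_residual N f h (x (Suc t) \<omega>) \<le> ennreal (resid_bound t \<omega>)"
proof -
  let ?p = "x (Suc t) \<omega>" and ?w = "v t \<omega>" and ?u = "x (Suc t) \<omega> - y t \<omega>"
  define \<xi> where "\<xi> = - (?w * (?p - (y t \<omega> - vdiv (g t \<omega>) ?w)))"
  have w: "?w $ i \<noteq> 0" for i using v_pos[OF \<omega>, of t i] by simp
  have "?w * (?p - (y t \<omega> - vdiv (g t \<omega>) ?w)) = ?w * ?u + ?w * vdiv (g t \<omega>) ?w"
    by (simp add: algebra_simps)
  then have \<xi>: "\<xi> = - (?w * ?u) - g t \<omega>" unfolding \<xi>_def mult_vdiv_cancel[OF w] by simp
  have "\<xi> \<in> frechet_subdiff h ?p"
    unfolding \<xi>_def using v_pos[OF \<omega>]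
    by (intro prox_frechet_subdiff x_step[OF \<omega>] h_x_finite[OF \<omega>]) (auto simp: less_imp_le)
  then have "\<xi> \<in> limiting_subdiff h ?p" using frechet_subset_limiting by blast
  then have "crit_residual N f h ?p \<le> ennreal (norm (grad fN ?p + \<xi>))"
    unfolding crit_residual_def by (rule INF_lower)
  also have "norm (grad fN ?p + \<xi>) \<le> resid_bound t \<omega>"
  proof -
    have u: "?u = d_seq x t \<omega> - sp t \<omega> *\<^sub>R dp t \<omega>" by (simp add: y_eq[OF \<omega>] d_seq_def)
    have wu: "?w * ?u = r_seq x v t \<omega> - ?w * (sp t \<omega> *\<^sub>R dp t \<omega>)"
      unfolding u r_seq_def by (simp add: right_diff_distrib)
    have 1: "norm ?u \<le> norm (d_seq x t \<omega>) + norm (dp t \<omega>)"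
      unfolding u using norm_triangle_ineq4 norm_sp_dp_le[OF \<omega>, of t] by (meson add_left_mono order_trans)
    have 2: "norm (?w * ?u) \<le> norm (r_seq x v t \<omega>) + norm (rp t \<omega>)"
      unfolding wu using norm_triangle_ineq4 norm_sp_v_dp_le[OF \<omega>, of t] by (meson add_left_mono order_trans)
    have "L * norm ?u \<le> L * (norm (d_seq x t \<omega>) + norm (dp t \<omega>))"
      using 1 L_nonneg by (rule mult_left_mono)
    then have 3: "norm (grad fN ?p - grad fN (y t \<omega>)) \<le> L * norm (d_seq x t \<omega>) + L * norm (dp t \<omega>)"
      using grad_favg_lipschitz[of ?p "y t \<omega>"] by (simp add: distrib_left)
    \<comment> \<open>Three sources: the change of the true gradient from \<open>y t\<close> to the
      new point, the weighted proximal displacement, and the estimator error.\<close>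
    have "grad fN ?p + \<xi> = (grad fN ?p - grad fN (y t \<omega>)) - (?w * ?u) - (g t \<omega> - grad fN (y t \<omega>))"
      unfolding \<xi> by simp
    also have "norm \<dots> \<le> norm (grad fN ?p - grad fN (y t \<omega>)) + norm (?w * ?u) + err t \<omega>"
      unfolding err_def by (meson add_right_mono norm_triangle_ineq4 order_trans)
    finally show ?thesis unfolding resid_bound_def using 2 3 by simp
  qed
  finally show ?thesis by (simp add: ennreal_leI)
qed

lemma sum_prev_le:
  fixes a :: "nat \<Rightarrow> real"
  assumes "\<And>t. 0 \<le> a t"
  shows "(\<Sum>t<T. if t = 0 then 0 else a (t - 1)) \<le> (\<Sum>t<T. a t)"
proof (cases T)
  case (Suc n)
  have "(\<Sum>t<T. if t = 0 then 0 else a (t - 1)) = (\<Sum>t<n. a t)"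
    unfolding Suc sum.lessThan_Suc_shift by simp
  then show ?thesis using assms[of n] Suc by simp
qed simp

text \<open>Cauchy-Schwarz on each of the five sums produces the factor \<open>sqrt T\<close>; the
  two shifted sums are dominated by the unshifted ones. The sum of the squared \<open>r\<close> is
  hidden in \<open>vhi T\<close>.\<close>

lemma sum_resid_bound_le:
  shows "(\<Sum>t<T. resid_bound t \<omega>)
     \<le> sqrt (real T) * ((1 + (\<Sum>t<T. (err t \<omega>)\<^sup>2)) + 2 * L * (1 + (\<Sum>t<T. (norm (d_seq x t \<omega>))\<^sup>2))
          + 2 / sqrt (\<alpha> + \<beta>) * vhi T \<omega>)"
proof -
  \<comment> \<open>Makes the bound linear in the sums of squares, so that expectations can be taken
    directly, without Jensen's inequality.\<close>
  have sqrt_le: "sqrt s \<le> 1 + s" if "s \<ge> 0" for s :: real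
    using that by (intro real_le_lsqrt) (auto simp: power2_eq_square algebra_simps)
  have cs: "(\<Sum>t<T. a t) \<le> sqrt (real T) * (1 + (\<Sum>t<T. (a t)\<^sup>2))" for a :: "nat \<Rightarrow> real"
    by (rule order_trans[OF sum_le_sqrt_card mult_left_mono[OF sqrt_le]]) (auto intro: sum_nonneg)
  have ab: "\<alpha> + \<beta> > 0" using \<alpha>_pos \<beta>_nonneg by simp
  have r: "(\<Sum>t<T. norm (r_seq x v t \<omega>)) \<le> sqrt (real T) * (vhi T \<omega> / sqrt (\<alpha> + \<beta>))"
  proof -
    have "sqrt (\<alpha> + \<beta>) * sqrt (rsum T \<omega>) \<le> vhi T \<omega>"
      unfolding vhi_def real_sqrt_mult[symmetric] by (rule real_sqrt_le_mono) simp
    then have "sqrt (rsum T \<omega>) \<le> vhi T \<omega> / sqrt (\<alpha> + \<beta>)" using ab by (simp add: pos_le_divide_eq mult_ac)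
    then show ?thesis unfolding rsum_def
      by (intro order_trans[OF sum_le_sqrt_card mult_left_mono]) auto
  qed
  have dp: "(\<Sum>t<T. norm (dp t \<omega>)) \<le> (\<Sum>t<T. norm (d_seq x t \<omega>))"
    using sum_prev_le[of "\<lambda>t. norm (d_seq x t \<omega>)" T] by (simp add: dp_def if_distrib cong: if_cong)
  have rp: "(\<Sum>t<T. norm (rp t \<omega>)) \<le> (\<Sum>t<T. norm (r_seq x v t \<omega>))"
    using sum_prev_le[of "\<lambda>t. norm (r_seq x v t \<omega>)" T] by (simp add: rp_def if_distrib cong: if_cong)
  have "(\<Sum>t<T. resid_bound t \<omega>) = (\<Sum>t<T. err t \<omega>) + L * ((\<Sum>t<T. norm (d_seq x t \<omega>)) + (\<Sum>t<T. norm (dp t \<omega>)))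
      + ((\<Sum>t<T. norm (r_seq x v t \<omega>)) + (\<Sum>t<T. norm (rp t \<omega>)))"
    unfolding resid_bound_def by (simp add: sum.distrib sum_distrib_left distrib_left)
  also have "\<dots> \<le> (\<Sum>t<T. err t \<omega>) + L * (2 * (\<Sum>t<T. norm (d_seq x t \<omega>))) + 2 * (\<Sum>t<T. norm (r_seq x v t \<omega>))"
    using dp rp L_nonneg by (intro add_mono mult_left_mono) auto
  also have "\<dots> \<le> sqrt (real T) * (1 + (\<Sum>t<T. (err t \<omega>)\<^sup>2))
      + L * (2 * (sqrt (real T) * (1 + (\<Sum>t<T. (norm (d_seq x t \<omega>))\<^sup>2))))
      + 2 * (sqrt (real T) * (vhi T \<omega> / sqrt (\<alpha> + \<beta>)))"
    using L_nonneg by (intro add_mono mult_left_mono cs r) auto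
  finally show ?thesis by (simp add: algebra_simps)
qed

text \<open>Extrapolation weights are at most \<open>1\<close>, so the distance is at most
  \<open>2 * norm d + norm dp\<close>; the square of a sum is at most twice the sum of the
  squares.\<close>

lemma norm_y_diff_sq:
  assumes \<omega>: "\<omega> \<in> space M"
  shows "(norm (y (Suc t) \<omega> - y t \<omega>))\<^sup>2 \<le> 8 * (norm (d_seq x t \<omega>))\<^sup>2 + 2 * (norm (dp t \<omega>))\<^sup>2"
proof -
  let ?d = "norm (d_seq x t \<omega>)" and ?p = "norm (dp t \<omega>)"
  have dpS: "dp (Suc t) \<omega> = d_seq x t \<omega>" by (simp add: dp_def)
  have "y (Suc t) \<omega> - y t \<omega> = d_seq x t \<omega> + sp (Suc t) \<omega> *\<^sub>R d_seq x t \<omega> - sp t \<omega> *\<^sub>R dp t \<omega>"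
    by (simp add: y_eq[OF \<omega>] dpS d_seq_def)
  also have "norm \<dots> \<le> norm (d_seq x t \<omega>) + norm (sp (Suc t) \<omega> *\<^sub>R d_seq x t \<omega>) + norm (sp t \<omega> *\<^sub>R dp t \<omega>)"
    by (meson add_right_mono norm_triangle_ineq norm_triangle_ineq4 order_trans)
  also have "\<dots> \<le> 2 * ?d + ?p"
    using norm_sp_dp_le[OF \<omega>, of "Suc t"] norm_sp_dp_le[OF \<omega>, of t] unfolding dpS by simp
  finally have "(norm (y (Suc t) \<omega> - y t \<omega>))\<^sup>2 \<le> (2 * ?d + ?p)\<^sup>2" by (intro power_mono) auto
  also have "\<dots> \<le> 8 * ?d\<^sup>2 + 2 * ?p\<^sup>2"
    using sum_squares_bound[of "2 * ?d" ?p] by (simp add: power2_eq_square algebra_simps)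
  finally show ?thesis .
qed

lemma sum_norm_y_diff_sq:
  assumes \<omega>: "\<omega> \<in> space M"
  shows "(\<Sum>t<T. (norm (y (Suc t) \<omega> - y t \<omega>))\<^sup>2) \<le> 10 * (\<Sum>t<T. (norm (d_seq x t \<omega>))\<^sup>2)"
proof -
  have "(\<Sum>t<T. (norm (dp t \<omega>))\<^sup>2) \<le> (\<Sum>t<T. (norm (d_seq x t \<omega>))\<^sup>2)"
    using sum_prev_le[of "\<lambda>t. (norm (d_seq x t \<omega>))\<^sup>2" T]
    by (simp add: dp_def if_distrib[of norm] if_distrib[of "\<lambda>a. a\<^sup>2"] cong: if_cong)
  moreover have "(\<Sum>t<T. (norm (y (Suc t) \<omega> - y t \<omega>))\<^sup>2)
      \<le> (\<Sum>t<T. 8 * (norm (d_seq x t \<omega>))\<^sup>2 + 2 * (norm (dp t \<omega>))\<^sup>2)"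
    by (rule sum_mono) (rule norm_y_diff_sq[OF \<omega>])
  ultimately show ?thesis by (simp add: sum.distrib sum_distrib_left[symmetric])
qed

end

subsection \<open>Measurability and expectations\<close>

lemma borel_measurable_vecI:
  fixes X :: "'a \<Rightarrow> real ^ 'n"
  assumes "\<And>i. (\<lambda>\<omega>. X \<omega> $ i) \<in> borel_measurable F"
  shows "X \<in> borel_measurable F"
proof (rule iffD2[OF borel_measurable_euclidean_space], rule ballI)
  fix k :: "real ^ 'n" assume "k \<in> Basis"
  then obtain i where k: "k = axis i 1" by (auto simp: Basis_vec_def)
  show "(\<lambda>\<omega>. inner (X \<omega>) k) \<in> borel_measurable F"
    unfolding k cart_eq_inner_axis[symmetric] by (rule assms)
qed

lemma measurable_norm:
  fixes X :: "'a \<Rightarrow> 'b::real_normed_vector"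
  assumes "X \<in> borel_measurable F"
  shows "(\<lambda>\<omega>. norm (X \<omega>)) \<in> borel_measurable F"
  by (rule measurable_compose[OF assms borel_measurable_norm])

lemma measurable_sqrt:
  assumes "X \<in> borel_measurable F"
  shows "(\<lambda>\<omega>. sqrt (X \<omega>)) \<in> borel_measurable F"
  by (rule measurable_compose[OF assms borel_measurable_sqrt])

lemma borel_measurable_component:
  fixes X :: "'a \<Rightarrow> real ^ 'n"
  assumes "X \<in> borel_measurable F"
  shows "(\<lambda>\<omega>. X \<omega> $ i) \<in> borel_measurable F"
  using measurable_compose[OF assms borel_measurable_nth] .

lemma borel_measurable_vmin:
  assumes "X \<in> borel_measurable F"
  shows "(\<lambda>\<omega>. vmin (X \<omega>)) \<in> borel_measurable F"
  unfolding vmin_def by (intro borel_measurable_Min borel_measurable_component assms) simp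

lemma borel_measurable_vdiv:
  assumes "X \<in> borel_measurable F" "Y \<in> borel_measurable F"
  shows "(\<lambda>\<omega>. vdiv (X \<omega>) (Y \<omega>)) \<in> borel_measurable F"
  by (rule borel_measurable_vecI)
     (simp add: vdiv_def borel_measurable_divide borel_measurable_component assms)

lemma borel_measurable_vec_mult:
  fixes X Y :: "'a \<Rightarrow> real ^ 'n"
  assumes "X \<in> borel_measurable F" "Y \<in> borel_measurable F"
  shows "(\<lambda>\<omega>. X \<omega> * Y \<omega>) \<in> borel_measurable F"
  by (rule borel_measurable_vecI)
     (simp add: borel_measurable_times borel_measurable_component assms)

lemma lipschitz_borel_measurable:
  fixes G :: "'a::real_normed_vector \<Rightarrow> 'b::real_normed_vector"
  assumes "\<And>u z. norm (G u - G z) \<le> L * norm (u - z)"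
  shows "G \<in> borel_measurable borel"
proof (rule borel_measurable_continuous_onI)
  have "norm (G u - G z) \<le> \<bar>L\<bar> * norm (u - z)" for u z
    by (rule order_trans[OF assms mult_right_mono]) auto
  then have "\<bar>L\<bar>-lipschitz_on UNIV G" by (intro lipschitz_onI) (auto simp: dist_norm)
  then show "continuous_on UNIV G" by (rule lipschitz_on_continuous_on)
qed

context composite_problem
begin

lemma batch_grad_lipschitz:
  assumes b: "b \<ge> 1" and J: "\<And>k. k < b \<Longrightarrow> J k \<in> {1..N}"
  shows "norm (batch_grad f b J u - batch_grad f b J z) \<le> L * norm (u - z)"
proof -
  have "batch_grad f b J u - batch_grad f b J z
      = (1 / real b) *\<^sub>R (\<Sum>k<b. grad (f (J k)) u - grad (f (J k)) z)"
    by (simp add: batch_grad_def sum_subtractf scaleR_diff_right)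
  then have "norm (batch_grad f b J u - batch_grad f b J z)
      = (1 / real b) * norm (\<Sum>k<b. grad (f (J k)) u - grad (f (J k)) z)" by simp
  also have "\<dots> \<le> (1 / real b) * (\<Sum>k<b. L * norm (u - z))"
    using J by (intro mult_left_mono order_trans[OF norm_sum] sum_mono L_smooth) auto
  also have "\<dots> = L * norm (u - z)" using b by simp
  finally show ?thesis .
qed

lemma measurable_grad_favg:
  assumes "X \<in> borel_measurable F"
  shows "(\<lambda>\<omega>. grad fN (X \<omega>)) \<in> borel_measurable F"
  using measurable_compose[OF assms lipschitz_borel_measurable] grad_favg_lipschitz by blast

lemma measurable_batch_grad:
  assumes X: "X \<in> borel_measurable F" and J: "\<And>k. k < b \<Longrightarrow> J k \<in> {1..N}"
  shows "(\<lambda>\<omega>. batch_grad f b J (X \<omega>)) \<in> borel_measurable F"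
  unfolding batch_grad_def
proof (intro borel_measurable_scaleR borel_measurable_const borel_measurable_sum)
  fix k assume "k \<in> {..<b}"
  then have "J k \<in> {1..N}" using J by simp
  then have "grad (f (J k)) \<in> borel_measurable borel"
    by (intro lipschitz_borel_measurable[OF L_smooth])
  then show "(\<lambda>\<omega>. grad (f (J k)) (X \<omega>)) \<in> borel_measurable F"
    by (rule measurable_compose[OF X])
qed

end

section \<open>The law of a mini-batch\<close>

text \<open>The product of uniform counting measures is uniform on the finite set of tuples, so each
  batch has mass \<open>1 / N ^ b\<close> and the law is handled through its atoms.\<close>

lemma
  assumes N: "N \<ge> 1"
  shows space_batch_law: "space (batch_law N b) = PiE {..<b} (\<lambda>_. {1..N})"
    and sets_batch_law_singleton: "J \<in> PiE {..<b} (\<lambda>_. {1..N}) \<Longrightarrow> {J} \<in> sets (batch_law N b)"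
    and measure_batch_law_singleton:
      "J \<in> PiE {..<b} (\<lambda>_. {1..N}) \<Longrightarrow> measure (batch_law N b) {J} = 1 / real N ^ b"
proof -
  show "space (batch_law N b) = PiE {..<b} (\<lambda>_. {1..N})"
    by (simp add: batch_law_def space_PiM space_uniform_count_measure)
  interpret U: prob_space "uniform_count_measure {1..N}"
    by (rule prob_space_uniform_count_measure) (use N in auto)
  interpret P: finite_product_prob_space "\<lambda>_. uniform_count_measure {1..N}" "{..<b}"
    by unfold_locales simp
  assume J: "J \<in> PiE {..<b} (\<lambda>_. {1..N})"
  have sing: "{J} = PiE {..<b} (\<lambda>k. {J k})"
    using J by (simp add: PiE_singleton PiE_iff)
  have Jk: "{J k} \<subseteq> {1..N}" if "k < b" for k using J that by (auto simp: PiE_def Pi_def)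
  show "{J} \<in> sets (batch_law N b)"
    unfolding batch_law_def sing
    by (rule sets_PiM_I_finite) (use Jk in \<open>auto simp: sets_uniform_count_measure\<close>)
  have "measure (batch_law N b) {J} = (\<Prod>k\<in>{..<b}. measure (uniform_count_measure {1..N}) {J k})"
    unfolding batch_law_def sing
    by (rule P.prob_times) (use Jk in \<open>auto simp: sets_uniform_count_measure\<close>)
  also have "\<dots> = (\<Prod>k\<in>{..<b}. 1 / real N)"
    by (rule prod.cong) (use Jk in \<open>auto simp: measure_uniform_count_measure\<close>)
  finally show "measure (batch_law N b) {J} = 1 / real N ^ b" by (simp add: power_one_over)
qed

section \<open>Explicit constants\<close>

definition energy_coeff :: "real \<Rightarrow> real \<Rightarrow> real \<Rightarrow> real" where
  "energy_coeff \<alpha> \<beta> \<theta> = (1 - \<theta>)\<^sup>2 / (\<alpha> + \<beta>)"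

text \<open>Here \<rho> stands for an upper bound of \<open>q / b\<close>, the only way in which the
  batch parameters enter. The term with \<rho> is half the constant
  \<open>10 * \<rho> * L\<^sup>2\<close> of the accumulated mini-batch errors.\<close>

definition log_coeff :: "real \<Rightarrow> real \<Rightarrow> real \<Rightarrow> real \<Rightarrow> real \<Rightarrow> real" where
  "log_coeff L xbar \<alpha> \<beta> \<rho> = (1 / 2 + 2 * L + 5 * \<rho> * L\<^sup>2) * (2 * growth_const xbar \<alpha> \<beta> / \<alpha>)"

text \<open>
  In \<open>A (E V - vlow) \<le> gap + B E (ln (V / vlow))\<close> the logarithm is replaced by
  \<open>\<delta> V / vlow - ln \<delta>\<close>, where \<open>\<delta> = A vlow / (2 B)\<close> is chosen such that half of the left-hand
  side absorbs the linear term.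
\<close>

definition vbound :: "real \<Rightarrow> real \<Rightarrow> real \<Rightarrow> real \<Rightarrow> real \<Rightarrow> real \<Rightarrow> real \<Rightarrow> real \<Rightarrow> real" where
  "vbound L xbar vlow \<alpha> \<beta> \<theta> \<rho> gap =
     2 / energy_coeff \<alpha> \<beta> \<theta> * (gap + energy_coeff \<alpha> \<beta> \<theta> * vlow
       - log_coeff L xbar \<alpha> \<beta> \<rho> * ln (energy_coeff \<alpha> \<beta> \<theta> * vlow / (2 * log_coeff L xbar \<alpha> \<beta> \<rho>)))"

text \<open>Bounds the expected sum of squared displacements, with the logarithm of
  \<open>V / vlow\<close> estimated by \<open>V / vlow\<close> itself.\<close>

definition dbound :: "real \<Rightarrow> real \<Rightarrow> real \<Rightarrow> real \<Rightarrow> real \<Rightarrow> real \<Rightarrow> real \<Rightarrow> real \<Rightarrow> real" where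
  "dbound L xbar vlow \<alpha> \<beta> \<theta> \<rho> gap =
     2 * growth_const xbar \<alpha> \<beta> / \<alpha> * (vbound L xbar vlow \<alpha> \<beta> \<theta> \<rho> gap / vlow)"

text \<open>The constant of the rate, kept as an explicit function of its arguments: for a fixed
  \<rho> it involves neither \<open>N\<close> nor the accuracy.\<close>

definition rbound :: "real \<Rightarrow> real \<Rightarrow> real \<Rightarrow> real \<Rightarrow> real \<Rightarrow> real \<Rightarrow> real \<Rightarrow> real \<Rightarrow> real" where
  "rbound L xbar vlow \<alpha> \<beta> \<theta> \<rho> gap =
     (1 + 10 * \<rho> * L\<^sup>2 * dbound L xbar vlow \<alpha> \<beta> \<theta> \<rho> gap)
       + 2 * L * (1 + dbound L xbar vlow \<alpha> \<beta> \<theta> \<rho> gap)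
       + 2 / sqrt (\<alpha> + \<beta>) * vbound L xbar vlow \<alpha> \<beta> \<theta> \<rho> gap"

context aepg_spider
begin

section \<open>Adaptedness of the processes\<close>

lemma space_Fil: "space (Fil t) = space M"
  by (rule space_F)

lemma measurable_Fil_mono: "s \<le> t \<Longrightarrow> X \<in> Fil s \<rightarrow>\<^sub>M K \<Longrightarrow> X \<in> Fil t \<rightarrow>\<^sub>M K"
  using sets_F_mono[of s t] by (auto simp: measurable_def space_Fil)

lemma measurable_Fil_M: "X \<in> Fil t \<rightarrow>\<^sub>M K \<Longrightarrow> X \<in> M \<rightarrow>\<^sub>M K"
  using Fil_sub[of t] by (auto simp: measurable_def space_Fil)

lemma measurable_d: "d_seq x t \<in> borel_measurable (Fil (Suc t))"
  unfolding d_seq_def[abs_def]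
  by (intro borel_measurable_diff x_adapted measurable_Fil_mono[OF _ x_adapted]) simp

lemma measurable_v: "v t \<in> borel_measurable (Fil t)"
proof (induction t rule: less_induct)
  case (less t)
  have r: "r_seq x v j \<in> borel_measurable (Fil t)" if "j < t" for j
    unfolding r_seq_def[abs_def]
    by (intro borel_measurable_vec_mult measurable_Fil_mono[OF _ less.IH] measurable_Fil_mono[OF _ measurable_d])
       (use that in auto)
  show ?case
  proof (rule borel_measurable_vecI)
    fix i
    have "(\<lambda>\<omega>. sqrt (vlow\<^sup>2 + (\<Sum>j<t. s_seq \<alpha> \<beta> x v j \<omega> $ i))) \<in> borel_measurable (Fil t)"
      unfolding s_seq_nth
      by (intro measurable_sqrt borel_measurable_add borel_measurable_sum borel_measurable_const
            borel_measurable_times borel_measurable_power measurable_norm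
            borel_measurable_component r) auto
    moreover have "(\<lambda>\<omega>. v t \<omega> $ i) \<in> borel_measurable (Fil t) \<longleftrightarrow>
        (\<lambda>\<omega>. sqrt (vlow\<^sup>2 + (\<Sum>j<t. s_seq \<alpha> \<beta> x v j \<omega> $ i))) \<in> borel_measurable (Fil t)"
      by (rule measurable_cong) (simp add: space_Fil v_nth)
    ultimately show "(\<lambda>\<omega>. v t \<omega> $ i) \<in> borel_measurable (Fil t)" by simp
  qed
qed

lemma measurable_r: "r_seq x v t \<in> borel_measurable (Fil (Suc t))"
  unfolding r_seq_def[abs_def]
  by (intro borel_measurable_vec_mult measurable_d measurable_Fil_mono[OF _ measurable_v]) simp

lemma measurable_dp: "dp t \<in> borel_measurable (Fil t)"
  using measurable_d[of "t - 1"] unfolding dp_def[abs_def] by (cases t) auto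

lemma measurable_sp: "sp t \<in> borel_measurable (Fil t)"
proof (induction t)
  case 0
  then show ?case by (simp add: sp_def[abs_def])
next
  case (Suc t)
  have "(\<lambda>\<omega>. \<theta> * (1 - sp t \<omega>) * vmin (vdiv (v t \<omega>) (v (Suc t) \<omega>))) \<in> borel_measurable (Fil (Suc t))"
    by (intro borel_measurable_times borel_measurable_diff borel_measurable_const borel_measurable_vmin
          borel_measurable_vdiv measurable_v measurable_Fil_mono[OF _ Suc.IH]
          measurable_Fil_mono[OF _ measurable_v]) auto
  moreover have "sp (Suc t) \<in> borel_measurable (Fil (Suc t)) \<longleftrightarrow>
      (\<lambda>\<omega>. \<theta> * (1 - sp t \<omega>) * vmin (vdiv (v t \<omega>) (v (Suc t) \<omega>))) \<in> borel_measurable (Fil (Suc t))"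
    by (rule measurable_cong) (simp add: space_Fil sp_Suc)
  ultimately show ?case by simp
qed

text \<open>The extrapolated point is known before the batch \<open>I t\<close> is drawn, so it can
  be frozen when averaging over that batch.\<close>

lemma measurable_y: "y t \<in> borel_measurable (Fil t)"
proof -
  have "(\<lambda>\<omega>. x t \<omega> + sp t \<omega> *\<^sub>R dp t \<omega>) \<in> borel_measurable (Fil t)"
    by (intro borel_measurable_add borel_measurable_scaleR x_adapted measurable_sp measurable_dp)
  moreover have "y t \<in> borel_measurable (Fil t) \<longleftrightarrow>
      (\<lambda>\<omega>. x t \<omega> + sp t \<omega> *\<^sub>R dp t \<omega>) \<in> borel_measurable (Fil t)"
    by (rule measurable_cong) (simp add: space_Fil y_eq)
  ultimately show ?thesis by simp
qed

abbreviation batches :: "(nat \<Rightarrow> nat) set" where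
  "batches \<equiv> PiE {..<b} (\<lambda>_. {1..N})"

lemma finite_batches: "finite batches"
  by (intro finite_PiE) auto

lemma I_in_batches: "\<not> q dvd t \<Longrightarrow> \<omega> \<in> space M \<Longrightarrow> I t \<omega> \<in> batches"
  using measurable_space[OF I_adapted] by (simp add: space_Fil space_batch_law[OF N_pos])

lemma batch_event:
  assumes "\<not> q dvd t" "J \<in> batches"
  shows "{\<omega> \<in> space M. I t \<omega> = J} \<in> sets (Fil (Suc t))"
proof -
  have "I t -` {J} \<inter> space (Fil (Suc t)) \<in> sets (Fil (Suc t))"
    using I_adapted[OF assms(1)] sets_batch_law_singleton[OF N_pos assms(2)] by (rule measurable_sets)
  moreover have "I t -` {J} \<inter> space (Fil (Suc t)) = {\<omega> \<in> space M. I t \<omega> = J}"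
    by (auto simp: space_Fil)
  ultimately show ?thesis by simp
qed

text \<open>A function of the random batch becomes a finite combination of indicators, which yields
  both measurability and expectations.\<close>

lemma batch_decompose:
  fixes \<phi> :: "(nat \<Rightarrow> nat) \<Rightarrow> 'c::real_vector"
  assumes "\<not> q dvd t" "\<omega> \<in> space M"
  shows "\<phi> (I t \<omega>) = (\<Sum>J\<in>batches. indicator {\<omega> \<in> space M. I t \<omega> = J} \<omega> *\<^sub>R \<phi> J)"
proof -
  have "(\<Sum>J\<in>batches. indicator {\<omega> \<in> space M. I t \<omega> = J} \<omega> *\<^sub>R \<phi> J)
      = (\<Sum>J\<in>batches. if J = I t \<omega> then \<phi> J else 0)"
    using assms(2) by (intro sum.cong) (auto simp: indicator_def)
  also have "\<dots> = \<phi> (I t \<omega>)"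
    using I_in_batches[OF assms] finite_batches by simp
  finally show ?thesis by simp
qed

text \<open>In contrast to \<open>y t\<close>, the estimator may use \<open>I t\<close> and is known
  only at time \<open>Suc t\<close>.\<close>

lemma measurable_g: "g t \<in> borel_measurable (Fil (Suc t))"
proof (induction t rule: less_induct)
  case (less t)
  show ?case
  proof (cases "q dvd t")
    case True
    have "(\<lambda>\<omega>. grad fN (y t \<omega>)) \<in> borel_measurable (Fil (Suc t))"
      by (intro measurable_grad_favg measurable_Fil_mono[OF _ measurable_y]) simp
    moreover have "g t \<in> borel_measurable (Fil (Suc t)) \<longleftrightarrow>
        (\<lambda>\<omega>. grad fN (y t \<omega>)) \<in> borel_measurable (Fil (Suc t))"
      by (rule measurable_cong) (simp add: space_Fil g_full True)
    ultimately show ?thesis by simp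
  next
    case False
    \<comment> \<open>As \<open>q\<close> divides \<open>0\<close>, a mini-batch step always has a
      predecessor.\<close>
    then obtain s where s: "t = Suc s" by (cases t) auto
    let ?G = "\<lambda>u \<omega>. (\<Sum>J\<in>batches. indicator {\<omega> \<in> space M. I t \<omega> = J} \<omega> *\<^sub>R batch_grad f b J (y u \<omega>))"
    have bg: "?G u \<in> borel_measurable (Fil (Suc t))" if "u \<le> t" for u
      using that False
      by (intro borel_measurable_sum borel_measurable_scaleR borel_measurable_indicator batch_event
            measurable_batch_grad measurable_Fil_mono[OF _ measurable_y]) (auto simp: PiE_iff)
    have "(\<lambda>\<omega>. g s \<omega> + ?G t \<omega> - ?G s \<omega>) \<in> borel_measurable (Fil (Suc t))"
      using s by (intro borel_measurable_add borel_measurable_diff bg measurable_Fil_mono[OF _ less.IH]) auto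
    moreover have "g t \<in> borel_measurable (Fil (Suc t)) \<longleftrightarrow>
        (\<lambda>\<omega>. g s \<omega> + ?G t \<omega> - ?G s \<omega>) \<in> borel_measurable (Fil (Suc t))"
    proof (rule measurable_cong)
      fix \<omega> assume "\<omega> \<in> space (Fil (Suc t))"
      then have \<omega>: "\<omega> \<in> space M" by (simp add: space_Fil)
      show "g t \<omega> = g s \<omega> + ?G t \<omega> - ?G s \<omega>"
        using g_batch[OF \<omega> False] batch_decompose[OF False \<omega>, of "\<lambda>J. batch_grad f b J (y t \<omega>)"]
          batch_decompose[OF False \<omega>, of "\<lambda>J. batch_grad f b J (y s \<omega>)"] s by simp
    qed
    ultimately show ?thesis by simp
  qed
qed

lemma measurable_err: "err t \<in> borel_measurable (Fil (Suc t))"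
  unfolding err_def[abs_def]
  by (intro measurable_norm borel_measurable_diff measurable_g measurable_grad_favg
        measurable_Fil_mono[OF _ measurable_y]) simp

lemma measurable_rsum: "rsum t \<in> borel_measurable M"
  unfolding rsum_def[abs_def]
  by (intro borel_measurable_sum borel_measurable_power measurable_norm
        measurable_Fil_M[OF measurable_r])

lemma measurable_vhi: "vhi t \<in> borel_measurable M"
  unfolding vhi_def[abs_def]
  by (intro measurable_sqrt borel_measurable_add borel_measurable_times borel_measurable_const
        measurable_rsum)

section \<open>Integrability from pathwise bounds\<close>

lemma integrable_bounded:
  fixes X :: "'w \<Rightarrow> real"
  assumes "X \<in> borel_measurable M" "\<And>\<omega>. \<omega> \<in> space M \<Longrightarrow> \<bar>X \<omega>\<bar> \<le> C"
  shows "integrable M X"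
  using assms by (intro integrable_const_bound[where B = C]) auto

lemma integrable_sq_bounded:
  fixes X :: "'w \<Rightarrow> real"
  assumes X: "X \<in> borel_measurable M" and le: "\<And>\<omega>. \<omega> \<in> space M \<Longrightarrow> \<bar>X \<omega>\<bar> \<le> C"
  shows "integrable M (\<lambda>\<omega>. (X \<omega>)\<^sup>2)"
proof (rule integrable_bounded)
  show "(\<lambda>\<omega>. (X \<omega>)\<^sup>2) \<in> borel_measurable M" by (rule borel_measurable_power[OF X])
  show "\<bar>(X \<omega>)\<^sup>2\<bar> \<le> C\<^sup>2" if "\<omega> \<in> space M" for \<omega>
    using power_mono[OF le[OF that], of 2] by simp
qed

lemma integrable_vhi: "integrable M (vhi t)"
  using vhi_bounded[of _ t] vhi_pos[of t]
  by (intro integrable_bounded[OF measurable_vhi]) (auto simp: abs_of_pos)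

lemma integrable_norm_d_sq: "integrable M (\<lambda>\<omega>. (norm (d_seq x t \<omega>))\<^sup>2)"
  using norm_d_le
  by (intro integrable_sq_bounded[where C = "2 * xbar"] measurable_norm measurable_Fil_M[OF measurable_d]) simp

lemma norm_y_diff_le:
  assumes \<omega>: "\<omega> \<in> space M"
  shows "norm (y (Suc t) \<omega> - y t \<omega>) \<le> 7 * xbar"
proof -
  have "(norm (d_seq x t \<omega>))\<^sup>2 \<le> (2 * xbar)\<^sup>2" "(norm (dp t \<omega>))\<^sup>2 \<le> (2 * xbar)\<^sup>2"
    using norm_d_le[OF \<omega>, of t] norm_dp_le[OF \<omega>, of t] by (intro power_mono; simp)+
  then have "(norm (y (Suc t) \<omega> - y t \<omega>))\<^sup>2 \<le> 40 * xbar\<^sup>2"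
    using norm_y_diff_sq[OF \<omega>, of t] by (simp add: power_mult_distrib)
  also have "\<dots> \<le> (7 * xbar)\<^sup>2" by (simp add: power_mult_distrib)
  finally have "(norm (y (Suc t) \<omega> - y t \<omega>))\<^sup>2 \<le> (7 * xbar)\<^sup>2" .
  then show ?thesis by (rule power2_le_imp_le) (use xbar_pos in simp)
qed

lemma integrable_norm_y_diff_sq: "integrable M (\<lambda>\<omega>. (norm (y (Suc t) \<omega> - y t \<omega>))\<^sup>2)"
  using norm_y_diff_le
  by (intro integrable_sq_bounded[where C = "7 * xbar"] measurable_norm borel_measurable_diff
        measurable_Fil_M[OF measurable_y]) simp

lemma batch_err_le:
  assumes \<omega>: "\<omega> \<in> space M" and J: "J \<in> batches"
  shows "norm (g t \<omega> + batch_grad f b J (y (Suc t) \<omega>) - batch_grad f b J (y t \<omega>) - grad fN (y (Suc t) \<omega>))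
     \<le> err t \<omega> + 14 * L * xbar"
proof -
  let ?B = "batch_grad f b J (y (Suc t) \<omega>) - batch_grad f b J (y t \<omega>)"
  let ?D = "grad fN (y (Suc t) \<omega>) - grad fN (y t \<omega>)"
  have Ln: "L * norm (y (Suc t) \<omega> - y t \<omega>) \<le> L * (7 * xbar)"
    using norm_y_diff_le[OF \<omega>] L_nonneg by (rule mult_left_mono)
  have 1: "norm ?B \<le> L * (7 * xbar)"
    using J by (intro order_trans[OF batch_grad_lipschitz[OF b_pos] Ln]) (auto simp: PiE_iff)
  have 2: "norm ?D \<le> L * (7 * xbar)" by (rule order_trans[OF grad_favg_lipschitz Ln])
  have eq: "g t \<omega> + batch_grad f b J (y (Suc t) \<omega>) - batch_grad f b J (y t \<omega>) - grad fN (y (Suc t) \<omega>)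
      = (g t \<omega> - grad fN (y t \<omega>)) + ?B - ?D" by simp
  have "norm ((g t \<omega> - grad fN (y t \<omega>)) + ?B - ?D) \<le> err t \<omega> + norm ?B + norm ?D"
    unfolding err_def by (meson add_right_mono norm_triangle_ineq norm_triangle_ineq4 order_trans)
  then show ?thesis unfolding eq using 1 2 by linarith
qed

lemma err_full: "\<omega> \<in> space M \<Longrightarrow> q dvd t \<Longrightarrow> err t \<omega> = 0"
  by (simp add: err_def g_full)

lemma err_batch:
  assumes "\<omega> \<in> space M" "\<not> q dvd Suc t"
  shows "err (Suc t) \<omega> = norm (g t \<omega> + batch_grad f b (I (Suc t) \<omega>) (y (Suc t) \<omega>)
      - batch_grad f b (I (Suc t) \<omega>) (y t \<omega>) - grad fN (y (Suc t) \<omega>))"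
  using g_batch[OF assms] by (simp add: err_def)

text \<open>Linear growth in \<open>t\<close> is harmless: only integrability is drawn from
  it.\<close>

lemma err_bounded: "\<omega> \<in> space M \<Longrightarrow> err t \<omega> \<le> real t * (14 * L * xbar)"
proof (induction t)
  case 0
  then show ?case by (simp add: err_full)
next
  case (Suc t)
  have pos: "0 \<le> 14 * L * xbar" using L_nonneg xbar_pos by simp
  show ?case
  proof (cases "q dvd Suc t")
    case True
    then show ?thesis using pos by (simp add: err_full Suc.prems)
  next
    case False
    have "err (Suc t) \<omega> \<le> err t \<omega> + 14 * L * xbar"
      unfolding err_batch[OF Suc.prems False]
      by (rule batch_err_le[OF Suc.prems I_in_batches[OF False Suc.prems]])
    then show ?thesis using Suc by (simp add: algebra_simps)
  qed
qed

lemma err_nonneg: "0 \<le> err t \<omega>"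
  by (simp add: err_def)

lemma integrable_err: "integrable M (err t)"
  using err_bounded[of _ t] err_nonneg[of t]
  by (intro integrable_bounded[OF measurable_Fil_M[OF measurable_err]]) auto

lemma integrable_err_sq: "integrable M (\<lambda>\<omega>. (err t \<omega>)\<^sup>2)"
  using err_bounded[of _ t] err_nonneg[of t]
  by (intro integrable_sq_bounded[where C = "real t * (14 * L * xbar)"]
        measurable_Fil_M[OF measurable_err]) simp

section \<open>Fresh mini-batches and the accumulated error\<close>

text \<open>Independence of \<open>Fil t\<close> and the algebra generated by \<open>I t\<close>
  passes to the smaller algebras generated by \<open>X\<close> and by the indicator.\<close>

lemma indep_batch:
  fixes X :: "'w \<Rightarrow> real"
  assumes q: "\<not> q dvd t" and J: "J \<in> batches" and X: "X \<in> borel_measurable (Fil t)"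
  shows "indep_var borel X borel (indicator {\<omega> \<in> space M. I t \<omega> = J} :: 'w \<Rightarrow> real)"
proof -
  let ?B = "{\<omega> \<in> space M. I t \<omega> = J}"
  let ?Y = "indicator ?B :: 'w \<Rightarrow> real"
  let ?V = "vimage_algebra (space M) (I t) (batch_law N b)"
  have sV: "sets ?V = {I t -` A \<inter> space M | A. A \<in> sets (batch_law N b)}"
    using measurable_space[OF I_adapted[OF q]] by (intro sets_vimage_algebra2) (auto simp: space_Fil)
  have "I t -` {J} \<inter> space M \<in> sets ?V"
    unfolding sV using sets_batch_law_singleton[OF N_pos J] by blast
  moreover have "I t -` {J} \<inter> space M = ?B" by auto
  ultimately have "?B \<in> sets ?V" by simp
  then have Y: "?Y \<in> borel_measurable ?V" by (rule borel_measurable_indicator)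
  have "{X -` A \<inter> space M | A. A \<in> sets borel} \<subseteq> sets (Fil t)"
    using measurable_sets[OF X] by (auto simp: space_Fil)
  then have 1: "sigma_sets (space M) {X -` A \<inter> space M | A. A \<in> sets borel} \<subseteq> sets (Fil t)"
    using sets.sigma_sets_subset[of _ "Fil t"] by (simp add: space_Fil)
  have "{?Y -` A \<inter> space M | A. A \<in> sets borel} \<subseteq> sets ?V"
    using measurable_sets[OF Y] by auto
  then have 2: "sigma_sets (space M) {?Y -` A \<inter> space M | A. A \<in> sets borel} \<subseteq> sets ?V"
    using sets.sigma_sets_subset[of _ ?V] by simp
  have "indep_set (sets (Fil t)) (sets ?V)" unfolding sV by (rule I_fresh[OF q])
  then have "indep_set (sigma_sets (space M) {X -` A \<inter> space M | A. A \<in> sets borel})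
      (sigma_sets (space M) {?Y -` A \<inter> space M | A. A \<in> sets borel})"
    unfolding indep_set_def
    by (rule indep_sets_mono_sets) (use 1 2 in \<open>auto split: bool.split\<close>)
  moreover have "?B \<in> sets M" using batch_event[OF q J] Fil_sub by blast
  ultimately show ?thesis
    unfolding indep_var_eq by (intro conjI measurable_Fil_M[OF X] borel_measurable_indicator)
qed

lemma prob_batch:
  assumes q: "\<not> q dvd t" and J: "J \<in> batches"
  shows "prob {\<omega> \<in> space M. I t \<omega> = J} = 1 / real N ^ b"
proof -
  have "prob (I t -` {J} \<inter> space M) = measure (distr M (batch_law N b) (I t)) {J}"
    using measurable_Fil_M[OF I_adapted[OF q]] sets_batch_law_singleton[OF N_pos J]
    by (intro measure_distr[symmetric])
  also have "\<dots> = 1 / real N ^ b" unfolding I_law[OF q] by (rule measure_batch_law_singleton[OF N_pos J])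
  finally show ?thesis by (simp add: vimage_def Int_def conj_commute)
qed

text \<open>
  Averaging over the finitely many batches replaces conditional expectations.
\<close>

lemma expectation_batch:
  fixes \<phi> :: "(nat \<Rightarrow> nat) \<Rightarrow> 'w \<Rightarrow> real"
  assumes q: "\<not> q dvd t"
    and meas: "\<And>J. J \<in> batches \<Longrightarrow> \<phi> J \<in> borel_measurable (Fil t)"
    and int: "\<And>J. J \<in> batches \<Longrightarrow> integrable M (\<phi> J)"
  shows "expectation (\<lambda>\<omega>. \<phi> (I t \<omega>) \<omega>) = expectation (\<lambda>\<omega>. (\<Sum>J\<in>batches. \<phi> J \<omega>) / real N ^ b)"
proof -
  let ?i = "\<lambda>J. indicator {\<omega> \<in> space M. I t \<omega> = J} :: 'w \<Rightarrow> real"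
  have ev: "{\<omega> \<in> space M. I t \<omega> = J} \<in> sets M" if "J \<in> batches" for J
    using batch_event[OF q that] Fil_sub by blast
  have ii: "integrable M (?i J)" if "J \<in> batches" for J
    using ev[OF that] by (intro integrable_real_indicator) (auto simp: emeasure_eq_measure)
  have "expectation (\<lambda>\<omega>. \<phi> (I t \<omega>) \<omega>) = expectation (\<lambda>\<omega>. \<Sum>J\<in>batches. \<phi> J \<omega> * ?i J \<omega>)"
  proof (rule Bochner_Integration.integral_cong[OF refl])
    fix \<omega> assume "\<omega> \<in> space M"
    from batch_decompose[OF q this, of "\<lambda>J. \<phi> J \<omega>"]
    show "\<phi> (I t \<omega>) \<omega> = (\<Sum>J\<in>batches. \<phi> J \<omega> * ?i J \<omega>)" by (simp add: mult.commute)
  qed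
  also have "\<dots> = (\<Sum>J\<in>batches. expectation (\<lambda>\<omega>. \<phi> J \<omega> * ?i J \<omega>))"
    by (intro Bochner_Integration.integral_sum indep_var_integrable indep_batch q meas int ii)
  also have "\<dots> = (\<Sum>J\<in>batches. expectation (\<phi> J) / real N ^ b)"
  proof (rule sum.cong[OF refl])
    fix J assume J: "J \<in> batches"
    have "expectation (\<lambda>\<omega>. \<phi> J \<omega> * ?i J \<omega>) = expectation (\<phi> J) * expectation (?i J)"
      by (intro indep_var_lebesgue_integral indep_batch q meas int ii J)
    also have "expectation (?i J) = 1 / real N ^ b"
      using prob_batch[OF q J] ev[OF J] by simp
    finally show "expectation (\<lambda>\<omega>. \<phi> J \<omega> * ?i J \<omega>) = expectation (\<phi> J) / real N ^ b" by simp
  qed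
  also have "\<dots> = expectation (\<lambda>\<omega>. (\<Sum>J\<in>batches. \<phi> J \<omega>) / real N ^ b)"
    using int by (simp add: sum_divide_distrib[symmetric])
  finally show ?thesis .
qed

lemma expectation_err_step:
  assumes q: "\<not> q dvd Suc t"
  shows "expectation (\<lambda>\<omega>. (err (Suc t) \<omega>)\<^sup>2)
     \<le> expectation (\<lambda>\<omega>. (err t \<omega>)\<^sup>2) + L\<^sup>2 / real b * expectation (\<lambda>\<omega>. (norm (y (Suc t) \<omega> - y t \<omega>))\<^sup>2)"
proof -
  define \<phi> where "\<phi> J \<omega> = (norm (g t \<omega> + batch_grad f b J (y (Suc t) \<omega>) - batch_grad f b J (y t \<omega>)
      - grad fN (y (Suc t) \<omega>)))\<^sup>2" for J \<omega>
  have meas: "\<phi> J \<in> borel_measurable (Fil (Suc t))" if "J \<in> batches" for J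
    unfolding \<phi>_def[abs_def] using that
    by (intro borel_measurable_power measurable_norm borel_measurable_diff borel_measurable_add
          measurable_g measurable_batch_grad measurable_grad_favg measurable_y
          measurable_Fil_mono[OF _ measurable_y]) (auto simp: PiE_iff)
  have int: "integrable M (\<phi> J)" if "J \<in> batches" for J
  proof (rule integrable_bounded[OF measurable_Fil_M[OF meas[OF that]]])
    fix \<omega> assume \<omega>: "\<omega> \<in> space M"
    have "\<phi> J \<omega> \<le> (real t * (14 * L * xbar) + 14 * L * xbar)\<^sup>2"
      unfolding \<phi>_def
      using order_trans[OF batch_err_le[OF \<omega> that, of t] add_right_mono[OF err_bounded[OF \<omega>]]]
      by (intro power_mono) auto
    then show "\<bar>\<phi> J \<omega>\<bar> \<le> (real t * (14 * L * xbar) + 14 * L * xbar)\<^sup>2" by (simp add: \<phi>_def)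
  qed
  have "expectation (\<lambda>\<omega>. (err (Suc t) \<omega>)\<^sup>2) = expectation (\<lambda>\<omega>. \<phi> (I (Suc t) \<omega>) \<omega>)"
    by (intro Bochner_Integration.integral_cong refl) (simp add: err_batch[OF _ q] \<phi>_def)
  also have "\<dots> = expectation (\<lambda>\<omega>. (\<Sum>J\<in>batches. \<phi> J \<omega>) / real N ^ b)"
    by (rule expectation_batch[OF q meas int])
  also have "\<dots> \<le> expectation (\<lambda>\<omega>. (err t \<omega>)\<^sup>2 + L\<^sup>2 / real b * (norm (y (Suc t) \<omega> - y t \<omega>))\<^sup>2)"
  proof (rule integral_mono)
    show "integrable M (\<lambda>\<omega>. (\<Sum>J\<in>batches. \<phi> J \<omega>) / real N ^ b)"
      by (intro integrable_divide_zero Bochner_Integration.integrable_sum int)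
    show "integrable M (\<lambda>\<omega>. (err t \<omega>)\<^sup>2 + L\<^sup>2 / real b * (norm (y (Suc t) \<omega> - y t \<omega>))\<^sup>2)"
      by (intro Bochner_Integration.integrable_add integrable_err_sq integrable_mult_right
            integrable_norm_y_diff_sq)
    fix \<omega>
    show "(\<Sum>J\<in>batches. \<phi> J \<omega>) / real N ^ b
        \<le> (err t \<omega>)\<^sup>2 + L\<^sup>2 / real b * (norm (y (Suc t) \<omega> - y t \<omega>))\<^sup>2"
      unfolding \<phi>_def err_def by (rule sampling_variance[OF b_pos])
  qed
  also have "\<dots> = expectation (\<lambda>\<omega>. (err t \<omega>)\<^sup>2)
      + L\<^sup>2 / real b * expectation (\<lambda>\<omega>. (norm (y (Suc t) \<omega> - y t \<omega>))\<^sup>2)"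
    by (simp add: integrable_err_sq integrable_norm_y_diff_sq)
  finally show ?thesis .
qed

text \<open>Each increment has variance of order \<open>1 / b\<close> and survives for at most
  \<open>q\<close> steps; the factor \<open>10\<close> converts steps of \<open>y\<close> into steps
  of \<open>x\<close>.\<close>

lemma expectation_err_sum:
  assumes \<rho>: "real q \<le> \<rho> * real b"
  shows "expectation (\<lambda>\<omega>. \<Sum>t<T. (err t \<omega>)\<^sup>2)
     \<le> 10 * \<rho> * L\<^sup>2 * expectation (\<lambda>\<omega>. \<Sum>t<T. (norm (d_seq x t \<omega>))\<^sup>2)"
proof (cases T)
  case 0
  then show ?thesis by simp
next
  case (Suc n)
  let ?e = "\<lambda>t. expectation (\<lambda>\<omega>. (err t \<omega>)\<^sup>2)"
  let ?y = "\<lambda>t. expectation (\<lambda>\<omega>. (norm (y (Suc t) \<omega> - y t \<omega>))\<^sup>2)"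
  let ?D = "expectation (\<lambda>\<omega>. \<Sum>t<T. (norm (d_seq x t \<omega>))\<^sup>2)"
  have D: "0 \<le> ?D" by (intro Bochner_Integration.integral_nonneg sum_nonneg) auto
  have "(\<Sum>s\<le>n. ?e s) \<le> real q * (\<Sum>s<n. L\<^sup>2 / real b * ?y s)"
  proof (rule spider_sum_bound[OF q_pos])
    show "?e t = 0" if "q dvd t" for t
      using that by (subst Bochner_Integration.integral_cong[OF refl, of _ _ "\<lambda>_. 0"]) (auto simp: err_full)
    show "0 \<le> L\<^sup>2 / real b * ?y t" for t
      by (intro mult_nonneg_nonneg Bochner_Integration.integral_nonneg) auto
    show "0 \<le> ?e t" for t by (intro Bochner_Integration.integral_nonneg) auto
  qed (rule expectation_err_step)
  also have "\<dots> \<le> real q * (\<Sum>s<T. L\<^sup>2 / real b * ?y s)"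
    \<comment> \<open>The range is enlarged by one nonnegative term to match the sum of
      displacements.\<close>
    using Suc by (intro mult_left_mono sum_mono2) (auto intro!: Bochner_Integration.integral_nonneg)
  also have "\<dots> = real q * (L\<^sup>2 / real b * (\<Sum>s<T. ?y s))" by (simp add: sum_distrib_left)
  also have "(\<Sum>s<T. ?y s) = expectation (\<lambda>\<omega>. \<Sum>s<T. (norm (y (Suc s) \<omega> - y s \<omega>))\<^sup>2)"
    by (simp add: integrable_norm_y_diff_sq)
  also have "real q * (L\<^sup>2 / real b * \<dots>) \<le> real q * (L\<^sup>2 / real b * (10 * ?D))"
  proof -
    have "expectation (\<lambda>\<omega>. \<Sum>s<T. (norm (y (Suc s) \<omega> - y s \<omega>))\<^sup>2)
        \<le> expectation (\<lambda>\<omega>. 10 * (\<Sum>t<T. (norm (d_seq x t \<omega>))\<^sup>2))"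
      by (intro integral_mono sum_norm_y_diff_sq Bochner_Integration.integrable_sum
            integrable_mult_right integrable_norm_y_diff_sq integrable_norm_d_sq)
    then show ?thesis by (intro mult_left_mono) auto
  qed
  also have "\<dots> \<le> (\<rho> * real b) * (L\<^sup>2 / real b * (10 * ?D))"
    using \<rho> D by (intro mult_right_mono) auto
  also have "\<dots> = 10 * \<rho> * L\<^sup>2 * ?D" using b_pos by simp
  finally show ?thesis
    using Suc by (simp add: integrable_err_sq lessThan_Suc_atMost)
qed

lemma integrable_resid_bound: "integrable M (resid_bound t)"
proof -
  have d: "integrable M (\<lambda>\<omega>. norm (d_seq x t \<omega>))" for t
    using norm_d_le[of _ t]
    by (intro integrable_bounded[where C = "2 * xbar"] measurable_norm
          measurable_Fil_M[OF measurable_d]) auto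
  have r: "integrable M (\<lambda>\<omega>. norm (r_seq x v t \<omega>))" for t
  proof (rule integrable_bounded)
    fix \<omega> assume \<omega>: "\<omega> \<in> space M"
    have "vhi t \<omega> * norm (d_seq x t \<omega>) \<le> (growth ^ t * vlow) * (2 * xbar)"
      using vhi_bounded[OF \<omega>, of t] norm_d_le[OF \<omega>, of t] vlow_pos growth_ge_1
      by (intro mult_mono) auto
    then show "\<bar>norm (r_seq x v t \<omega>)\<bar> \<le> (growth ^ t * vlow) * (2 * xbar)"
      using norm_r_le[OF \<omega>, of t] by simp
  qed (intro measurable_norm measurable_Fil_M[OF measurable_r])
  have "integrable M (\<lambda>\<omega>. norm (dp t \<omega>))" using d[of "t - 1"] by (cases "t = 0") (simp_all add: dp_def)
  moreover have "integrable M (\<lambda>\<omega>. norm (rp t \<omega>))" using r[of "t - 1"] by (cases "t = 0") (simp_all add: rp_def)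
  ultimately show ?thesis
    unfolding resid_bound_def[abs_def]
    by (intro Bochner_Integration.integrable_add integrable_mult_right integrable_err d r)
qed

section \<open>Uniform bounds in expectation\<close>

context
  fixes \<rho> gap :: real
  assumes \<rho>: "real q \<le> \<rho> * real b"
    and gap: "objective N f h x0 - (INF z. objective N f h z) = ereal gap"
begin

abbreviation "vB \<equiv> vbound L xbar vlow \<alpha> \<beta> \<theta> \<rho> gap"
abbreviation "dB \<equiv> dbound L xbar vlow \<alpha> \<beta> \<theta> \<rho> gap"
abbreviation "rB \<equiv> rbound L xbar vlow \<alpha> \<beta> \<theta> \<rho> gap"
abbreviation "EV T \<equiv> expectation (vhi T)"
abbreviation "ED T \<equiv> expectation (\<lambda>\<omega>. \<Sum>t<T. (norm (d_seq x t \<omega>))\<^sup>2)"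

lemma \<rho>_nonneg: "0 \<le> \<rho>"
proof -
  have "0 \<le> \<rho> * real b" using \<rho> by linarith
  then show ?thesis using b_pos by (simp add: zero_le_mult_iff)
qed

lemma integrable_sum_d: "integrable M (\<lambda>\<omega>. \<Sum>t<T. (norm (d_seq x t \<omega>))\<^sup>2)"
  by (intro Bochner_Integration.integrable_sum integrable_norm_d_sq)

lemma integrable_sum_err: "integrable M (\<lambda>\<omega>. \<Sum>t<T. (err t \<omega>)\<^sup>2)"
  by (intro Bochner_Integration.integrable_sum integrable_err_sq)

lemma ED_le_EV:
  assumes "\<delta> > 0"
  shows "ED T \<le> 2 * growth / \<alpha> * (\<delta> * (EV T / vlow) - ln \<delta>)"
proof -
  have K: "0 \<le> 2 * growth / \<alpha>" using growth_ge_1 \<alpha>_pos by simp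
  have "ED T \<le> expectation (\<lambda>\<omega>. 2 * growth / \<alpha> * (\<delta> * (vhi T \<omega> / vlow) - ln \<delta>))"
  proof (rule integral_mono)
    show "integrable M (\<lambda>\<omega>. 2 * growth / \<alpha> * (\<delta> * (vhi T \<omega> / vlow) - ln \<delta>))"
      by (intro integrable_mult_right Bochner_Integration.integrable_diff integrable_divide_zero
            integrable_vhi integrable_const)
    fix \<omega> assume \<omega>: "\<omega> \<in> space M"
    have "ln (vhi T \<omega> / vlow) \<le> \<delta> * (vhi T \<omega> / vlow) - ln \<delta>"
      using vhi_pos[of T \<omega>] vlow_pos assms by (intro ln_linear_bound) auto
    then show "(\<Sum>t<T. (norm (d_seq x t \<omega>))\<^sup>2) \<le> 2 * growth / \<alpha> * (\<delta> * (vhi T \<omega> / vlow) - ln \<delta>)"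
      by (intro order_trans[OF sum_norm_d_sq_le[OF \<omega>] mult_left_mono] K)
  qed (rule integrable_sum_d)
  also have "\<dots> = 2 * growth / \<alpha> * (\<delta> * (EV T / vlow) - ln \<delta>)"
    by (simp add: integrable_vhi prob_space)
  finally show ?thesis .
qed

text \<open>A self-bounding estimate: \<open>EV T\<close> is bounded by its own logarithm-type term,
  and subtracting half of it is legitimate because \<open>EV T\<close> is already known to be
  finite.\<close>

lemma EV_le: "EV T \<le> vB"
proof -
  define A where "A = energy_coeff \<alpha> \<beta> \<theta>"
  define B where "B = 1 / 2 + 2 * L + 5 * \<rho> * L\<^sup>2"
  define K where "K = 2 * growth / \<alpha>"
  have A: "A > 0" unfolding A_def energy_coeff_def using \<theta>_range \<alpha>_pos \<beta>_nonneg by simp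
  have B: "B > 0" unfolding B_def using L_nonneg \<rho>_nonneg by (intro add_pos_nonneg) auto
  have K: "K > 0" unfolding K_def using growth_ge_1 \<alpha>_pos by simp
  define \<delta> where "\<delta> = A * vlow / (2 * (B * K))"
  have \<delta>: "\<delta> > 0" unfolding \<delta>_def using A B K vlow_pos by simp
  have "A * (EV T - vlow) = expectation (\<lambda>\<omega>. A * (vhi T \<omega> - vlow))"
    by (simp add: integrable_vhi prob_space)
  also have "\<dots> \<le> expectation (\<lambda>\<omega>. gap + 1 / 2 * (\<Sum>t<T. (err t \<omega>)\<^sup>2)
      + (1 / 2 + 2 * L) * (\<Sum>t<T. (norm (d_seq x t \<omega>))\<^sup>2))"
    unfolding A_def energy_coeff_def
    by (intro integral_mono energy_bound gap Bochner_Integration.integrable_add integrable_mult_right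
          integrable_const integrable_sum_d integrable_sum_err Bochner_Integration.integrable_diff integrable_vhi)
  also have "\<dots> = gap + 1 / 2 * expectation (\<lambda>\<omega>. \<Sum>t<T. (err t \<omega>)\<^sup>2) + (1 / 2 + 2 * L) * ED T"
    using integrable_sum_d[of T] integrable_sum_err[of T] by (simp add: prob_space del: Bochner_Integration.integral_sum)
  also have "\<dots> \<le> gap + B * ED T"
    using expectation_err_sum[OF \<rho>, of T] unfolding B_def by (simp add: algebra_simps)
  also have "\<dots> \<le> gap + B * (K * (\<delta> * (EV T / vlow) - ln \<delta>))"
    using ED_le_EV[OF \<delta>] B unfolding K_def by (intro add_left_mono mult_left_mono) auto
  also have "\<dots> = gap + A / 2 * EV T - B * K * ln \<delta>"
    using A B K vlow_pos by (simp add: \<delta>_def field_simps)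
  finally have "A * EV T \<le> 2 * (gap + A * vlow - B * K * ln \<delta>)"
    by (simp add: algebra_simps)
  then have "EV T \<le> 2 / A * (gap + A * vlow - B * K * ln \<delta>)"
    using A by (simp add: field_simps)
  then show ?thesis
    by (simp add: vbound_def log_coeff_def A_def B_def K_def \<delta>_def)
qed

text \<open>The case \<open>T = 0\<close>; it certifies that the explicit formula for
  \<open>vB\<close> is positive.\<close>

lemma vlow_le_W: "vlow \<le> vB"
  using EV_le[of 0] vlow_pos by (simp add: vhi_def[abs_def] rsum_def prob_space)

lemma ED_le: "ED T \<le> dB"
proof -
  have "ED T \<le> 2 * growth / \<alpha> * (EV T / vlow)" using ED_le_EV[of 1 T] by simp
  also have "\<dots> \<le> 2 * growth / \<alpha> * (vB / vlow)"
    using EV_le growth_ge_1 \<alpha>_pos vlow_pos by (intro mult_left_mono divide_right_mono) auto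
  finally show ?thesis by (simp add: dbound_def)
qed

lemma D_nonneg: "0 \<le> dB"
  using ED_le[of 0] by simp

lemma sum_expectation_resid: "(\<Sum>t<T. expectation (resid_bound t)) \<le> sqrt (real T) * rB"
proof -
  have ab: "\<alpha> + \<beta> > 0" using \<alpha>_pos \<beta>_nonneg by simp
  have "(\<Sum>t<T. expectation (resid_bound t)) = expectation (\<lambda>\<omega>. \<Sum>t<T. resid_bound t \<omega>)"
    by (simp add: integrable_resid_bound)
  also have "\<dots> \<le> expectation (\<lambda>\<omega>. sqrt (real T) * ((1 + (\<Sum>t<T. (err t \<omega>)\<^sup>2))
      + 2 * L * (1 + (\<Sum>t<T. (norm (d_seq x t \<omega>))\<^sup>2)) + 2 / sqrt (\<alpha> + \<beta>) * vhi T \<omega>))"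
    by (intro integral_mono sum_resid_bound_le Bochner_Integration.integrable_add
          Bochner_Integration.integrable_sum integrable_mult_right
          integrable_const integrable_norm_d_sq integrable_err_sq integrable_vhi integrable_resid_bound)
  also have "\<dots> = sqrt (real T) * ((1 + expectation (\<lambda>\<omega>. \<Sum>t<T. (err t \<omega>)\<^sup>2))
      + 2 * L * (1 + ED T) + 2 / sqrt (\<alpha> + \<beta>) * EV T)"
    using integrable_sum_d[of T] integrable_sum_err[of T] integrable_vhi[of T]
    by (simp add: prob_space del: Bochner_Integration.integral_sum)
  also have "\<dots> \<le> sqrt (real T) * rB"
    unfolding rbound_def
  proof (intro mult_left_mono add_mono order_refl EV_le ED_le)
    have "expectation (\<lambda>\<omega>. \<Sum>t<T. (err t \<omega>)\<^sup>2) \<le> 10 * \<rho> * L\<^sup>2 * ED T"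
      by (rule expectation_err_sum[OF \<rho>])
    also have "\<dots> \<le> 10 * \<rho> * L\<^sup>2 * dB" using \<rho>_nonneg by (intro mult_left_mono ED_le) auto
    finally show "expectation (\<lambda>\<omega>. \<Sum>t<T. (err t \<omega>)\<^sup>2) \<le> 10 * \<rho> * L\<^sup>2 * dB" .
  qed (use L_nonneg ab in auto)
  finally show ?thesis .
qed

lemma nn_integral_V_cal: "(\<integral>\<^sup>+\<omega>. ennreal (V_cal vlow \<alpha> \<beta> x v t \<omega>) \<partial>M) \<le> ennreal vB"
proof -
  have "(\<integral>\<^sup>+\<omega>. ennreal (vhi t \<omega>) \<partial>M) = ennreal (EV t)"
    by (intro nn_integral_eq_integral integrable_vhi AE_I2 less_imp_le vhi_pos)
  then show ?thesis unfolding V_cal_eq using EV_le by (simp add: ennreal_leI)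
qed

lemma nn_integral_sum_d:
  "(\<integral>\<^sup>+\<omega>. ennreal (\<Sum>t\<le>T. (norm (x (Suc t) \<omega> - x t \<omega>))\<^sup>2) \<partial>M) \<le> ennreal dB"
proof -
  have "(\<integral>\<^sup>+\<omega>. ennreal (\<Sum>t<Suc T. (norm (d_seq x t \<omega>))\<^sup>2) \<partial>M) = ennreal (ED (Suc T))"
    by (intro nn_integral_eq_integral integrable_sum_d AE_I2 sum_nonneg) auto
  also have "\<dots> \<le> ennreal dB" by (rule ennreal_leI[OF ED_le])
  finally show ?thesis unfolding lessThan_Suc_atMost d_seq_def .
qed

lemma nn_integral_crit_residual:
  "(\<integral>\<^sup>+\<omega>. crit_residual N f h (x (Suc t) \<omega>) \<partial>M) \<le> ennreal (expectation (resid_bound t))"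
proof -
  have "(\<integral>\<^sup>+\<omega>. crit_residual N f h (x (Suc t) \<omega>) \<partial>M) \<le> (\<integral>\<^sup>+\<omega>. ennreal (resid_bound t \<omega>) \<partial>M)"
    by (intro nn_integral_mono crit_residual_le)
  also have "\<dots> = ennreal (expectation (resid_bound t))"
    by (intro nn_integral_eq_integral integrable_resid_bound AE_I2 resid_bound_nonneg)
  finally show ?thesis .
qed

lemma nn_integral_average_residual:
  assumes T: "T \<ge> 1"
  shows "(\<integral>\<^sup>+\<omega>. (\<Sum>t\<le>T. crit_residual N f h (x (Suc t) \<omega>)) / of_nat (T + 1) \<partial>M)
     \<le> ennreal (\<bar>rB\<bar> / sqrt (real T))"
proof -
  let ?n = "real (T + 1)"
  have "(\<integral>\<^sup>+\<omega>. (\<Sum>t\<le>T. crit_residual N f h (x (Suc t) \<omega>)) / of_nat (T + 1) \<partial>M)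
      \<le> (\<integral>\<^sup>+\<omega>. ennreal ((\<Sum>t\<le>T. resid_bound t \<omega>) / ?n) \<partial>M)"
  proof (rule nn_integral_mono)
    fix \<omega> assume \<omega>: "\<omega> \<in> space M"
    have "(\<Sum>t\<le>T. crit_residual N f h (x (Suc t) \<omega>)) \<le> (\<Sum>t\<le>T. ennreal (resid_bound t \<omega>))"
      by (rule sum_mono) (rule crit_residual_le[OF \<omega>])
    also have "\<dots> = ennreal (\<Sum>t\<le>T. resid_bound t \<omega>)"
      by (rule sum_ennreal) (rule resid_bound_nonneg)
    finally have "(\<Sum>t\<le>T. crit_residual N f h (x (Suc t) \<omega>)) / of_nat (T + 1)
        \<le> ennreal (\<Sum>t\<le>T. resid_bound t \<omega>) / of_nat (T + 1)"
      by (rule divide_right_mono_ennreal)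
    also have "\<dots> = ennreal ((\<Sum>t\<le>T. resid_bound t \<omega>) / ?n)"
      unfolding ennreal_of_nat_eq_real_of_nat
      by (rule divide_ennreal) (auto intro!: sum_nonneg resid_bound_nonneg)
    finally show "(\<Sum>t\<le>T. crit_residual N f h (x (Suc t) \<omega>)) / of_nat (T + 1)
        \<le> ennreal ((\<Sum>t\<le>T. resid_bound t \<omega>) / ?n)" .
  qed
  also have "\<dots> = ennreal (expectation (\<lambda>\<omega>. (\<Sum>t\<le>T. resid_bound t \<omega>) / ?n))"
    by (intro nn_integral_eq_integral integrable_divide_zero Bochner_Integration.integrable_sum
          integrable_resid_bound AE_I2 divide_nonneg_nonneg sum_nonneg resid_bound_nonneg) auto
  also have "expectation (\<lambda>\<omega>. (\<Sum>t\<le>T. resid_bound t \<omega>) / ?n) = (\<Sum>t<Suc T. expectation (resid_bound t)) / ?n"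
    unfolding lessThan_Suc_atMost by (simp add: integrable_resid_bound)
  also have "ennreal \<dots> \<le> ennreal (\<bar>rB\<bar> / sqrt (real T))"
  proof (rule ennreal_leI)
    have "(\<Sum>t<Suc T. expectation (resid_bound t)) / ?n \<le> sqrt ?n * rB / ?n"
      using sum_expectation_resid[of "Suc T"] by (intro divide_right_mono) auto
    \<comment> \<open>The absolute value makes the passage from \<open>T + 1\<close> to
      \<open>T\<close> in the denominator monotone whatever the sign of \<open>rB\<close>.\<close>
    also have "\<dots> \<le> sqrt ?n * \<bar>rB\<bar> / ?n" by (intro divide_right_mono mult_left_mono) auto
    also have "\<dots> = \<bar>rB\<bar> / sqrt ?n"
    proof -
      have "?n = sqrt ?n * sqrt ?n" by simp
      moreover have "sqrt ?n > 0" by simp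
      ultimately show ?thesis by (metis mult.commute mult_divide_mult_cancel_left_if order_less_irrefl)
    qed
    also have "\<dots> \<le> \<bar>rB\<bar> / sqrt (real T)" using T by (intro divide_left_mono) auto
    finally show "(\<Sum>t<Suc T. expectation (resid_bound t)) / ?n \<le> \<bar>rB\<bar> / sqrt (real T)" .
  qed
  finally show ?thesis .
qed

text \<open>If all \<open>T\<close> expected majorants exceeded \<epsilon>, their sum would exceed
  \<open>T * \<epsilon>\<close>, against the bound of order \<open>sqrt T\<close>.\<close>

lemma exists_small_residual:
  assumes T: "T \<ge> 1" and \<epsilon>: "\<epsilon> > 0" and le: "rB\<^sup>2 / \<epsilon>\<^sup>2 \<le> real T"
  shows "\<exists>t\<in>{1..T}. (\<integral>\<^sup>+\<omega>. crit_residual N f h (x t \<omega>) \<partial>M) \<le> ennreal \<epsilon>"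
proof -
  have "\<exists>s<T. expectation (resid_bound s) \<le> \<epsilon>"
  proof (rule ccontr)
    assume "\<not> ?thesis"
    then have "(\<Sum>t<T. \<epsilon>) < (\<Sum>t<T. expectation (resid_bound t))"
      using T by (intro sum_strict_mono) (auto simp: not_le lessThan_empty_iff)
    also have "\<dots> \<le> sqrt (real T) * rB" by (rule sum_expectation_resid)
    finally have "sqrt (real T) * (sqrt (real T) * \<epsilon>) < sqrt (real T) * rB"
      by (simp add: mult.assoc[symmetric])
    then have "sqrt (real T) * \<epsilon> < rB" using T by simp
    then have "(sqrt (real T) * \<epsilon>)\<^sup>2 < rB\<^sup>2" using \<epsilon> by (intro power_strict_mono) auto
    then show False using le \<epsilon> by (simp add: power_mult_distrib pos_divide_le_eq)
  qed
  then obtain s where s: "s < T" "expectation (resid_bound s) \<le> \<epsilon>" by blast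
  have "(\<integral>\<^sup>+\<omega>. crit_residual N f h (x (Suc s) \<omega>) \<partial>M) \<le> ennreal \<epsilon>"
    using nn_integral_crit_residual[of s] ennreal_leI[OF s(2)] by (rule order_trans)
  then show ?thesis using s(1) by (intro bexI[of _ "Suc s"]) auto
qed

end

section \<open>Rates and complexity\<close>

lemma gap_finite: "\<exists>gap. objective N f h x0 - (INF z. objective N f h z) = ereal gap"
proof -
  have "(INF z. objective N f h z) \<le> objective N f h x0" by (rule INF_lower) simp
  moreover have "\<bar>h x0\<bar> \<noteq> \<infinity>" unfolding h_finite_iff by (rule x0_dom)
  ultimately show ?thesis using objective_bounded_below
    by (cases "h x0"; cases "INF z. objective N f h z") (auto simp: objective_def)
qed

lemma convergence_rates:
  "\<exists>vbar > 0.
     (\<forall>t. (\<integral>\<^sup>+\<omega>. ennreal (V_cal vlow \<alpha> \<beta> x v t \<omega>) \<partial>M) \<le> ennreal vbar) \<and>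
     (\<forall>T\<ge>1. (\<integral>\<^sup>+\<omega>. ennreal (\<Sum>t\<le>T. (norm (x (Suc t) \<omega> - x t \<omega>))\<^sup>2) \<partial>M)
              \<le> ennreal (1 / \<alpha> * ((vbar / vlow)\<^sup>2 - 1))) \<and>
     (\<exists>C > 0. \<forall>T\<ge>1.
        (\<integral>\<^sup>+\<omega>. (\<Sum>t\<le>T. crit_residual N f h (x (Suc t) \<omega>)) / of_nat (T + 1) \<partial>M)
          \<le> ennreal (C / sqrt (real T))) \<and>
     (\<exists>C > 0. \<forall>\<epsilon> > 0. \<forall>T\<ge>1. real T \<ge> C / \<epsilon>\<^sup>2 \<longrightarrow>
        (\<exists>t\<in>{1..T}. (\<integral>\<^sup>+\<omega>. crit_residual N f h (x t \<omega>) \<partial>M) \<le> ennreal \<epsilon>))"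
proof -
  obtain gap where gap: "objective N f h x0 - (INF z. objective N f h z) = ereal gap"
    using gap_finite by blast
  \<comment> \<open>For general \<open>q\<close> and \<open>b\<close> the ratio itself is taken; the
    constants may depend on it here.\<close>
  define \<rho> where "\<rho> = real q / real b"
  have \<rho>: "real q \<le> \<rho> * real b" using b_pos by (simp add: \<rho>_def)
  let ?W = "vbound L xbar vlow \<alpha> \<beta> \<theta> \<rho> gap" and ?D = "dbound L xbar vlow \<alpha> \<beta> \<theta> \<rho> gap"
    and ?R = "rbound L xbar vlow \<alpha> \<beta> \<theta> \<rho> gap"
  \<comment> \<open>The bound for \<open>V\<close> is enlarged so that the prescribed expression in
    \<open>vbar\<close> also dominates \<open>dbound\<close>: the second summand alone gives
    \<open>(vbar / vlow)\<^sup>2 - 1 \<ge> \<alpha> * ?D\<close>.\<close>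
  define vbar where "vbar = ?W + vlow * sqrt (1 + \<alpha> * ?D)"
  have W: "?W > 0" using vlow_le_W[OF \<rho> gap] vlow_pos by linarith
  have aD: "0 \<le> \<alpha> * ?D" using D_nonneg[OF \<rho> gap] \<alpha>_pos by simp
  have vs: "0 \<le> vlow * sqrt (1 + \<alpha> * ?D)" using vlow_pos aD by simp
  have pos: "vbar > 0" and Wle: "?W \<le> vbar" unfolding vbar_def using W vs by linarith+
  have "sqrt (1 + \<alpha> * ?D) \<le> vbar / vlow"
    unfolding vbar_def using W vlow_pos by (simp add: field_simps)
  then have "(sqrt (1 + \<alpha> * ?D))\<^sup>2 \<le> (vbar / vlow)\<^sup>2" using aD by (intro power_mono) auto
  then have "\<alpha> * ?D \<le> (vbar / vlow)\<^sup>2 - 1" using aD by simp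
  then have Dle: "?D \<le> 1 / \<alpha> * ((vbar / vlow)\<^sup>2 - 1)" using \<alpha>_pos by (simp add: field_simps)
  show ?thesis
  proof (rule exI[of _ vbar], intro conjI allI impI)
    show "vbar > 0" by (rule pos)
    show "(\<integral>\<^sup>+\<omega>. ennreal (V_cal vlow \<alpha> \<beta> x v t \<omega>) \<partial>M) \<le> ennreal vbar" for t
      using nn_integral_V_cal[OF \<rho> gap] ennreal_leI[OF Wle] by (rule order_trans)
    show "(\<integral>\<^sup>+\<omega>. ennreal (\<Sum>t\<le>T. (norm (x (Suc t) \<omega> - x t \<omega>))\<^sup>2) \<partial>M)
        \<le> ennreal (1 / \<alpha> * ((vbar / vlow)\<^sup>2 - 1))" for T
      using nn_integral_sum_d[OF \<rho> gap] ennreal_leI[OF Dle] by (rule order_trans)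
    show "\<exists>C > 0. \<forall>T\<ge>1.
        (\<integral>\<^sup>+\<omega>. (\<Sum>t\<le>T. crit_residual N f h (x (Suc t) \<omega>)) / of_nat (T + 1) \<partial>M)
          \<le> ennreal (C / sqrt (real T))"
    proof (intro exI[of _ "1 + \<bar>?R\<bar>"] conjI allI impI)
      fix T :: nat assume T: "T \<ge> 1"
      have "\<bar>?R\<bar> / sqrt (real T) \<le> (1 + \<bar>?R\<bar>) / sqrt (real T)" by (intro divide_right_mono) auto
      then show "(\<integral>\<^sup>+\<omega>. (\<Sum>t\<le>T. crit_residual N f h (x (Suc t) \<omega>)) / of_nat (T + 1) \<partial>M)
          \<le> ennreal ((1 + \<bar>?R\<bar>) / sqrt (real T))"
        by (rule order_trans[OF nn_integral_average_residual[OF \<rho> gap T] ennreal_leI])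
    qed simp
    show "\<exists>C > 0. \<forall>\<epsilon> > 0. \<forall>T\<ge>1. real T \<ge> C / \<epsilon>\<^sup>2 \<longrightarrow>
        (\<exists>t\<in>{1..T}. (\<integral>\<^sup>+\<omega>. crit_residual N f h (x t \<omega>) \<partial>M) \<le> ennreal \<epsilon>)"
    proof (intro exI[of _ "1 + ?R\<^sup>2"] conjI allI impI)
      fix \<epsilon> :: real and T :: nat
      assume \<epsilon>: "\<epsilon> > 0" and T: "T \<ge> 1" and le: "(1 + ?R\<^sup>2) / \<epsilon>\<^sup>2 \<le> real T"
      have "?R\<^sup>2 / \<epsilon>\<^sup>2 \<le> (1 + ?R\<^sup>2) / \<epsilon>\<^sup>2" by (intro divide_right_mono) auto
      then have "?R\<^sup>2 / \<epsilon>\<^sup>2 \<le> real T" using le by linarith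
      then show "\<exists>t\<in>{1..T}. (\<integral>\<^sup>+\<omega>. crit_residual N f h (x t \<omega>) \<partial>M) \<le> ennreal \<epsilon>"
        by (rule exists_small_residual[OF \<rho> gap T \<epsilon>])
    qed (simp add: add_pos_nonneg)
  qed
qed

text \<open>With \<open>b = q\<close> the ratio is \<open>1\<close>, so the iteration count is
  independent of \<open>N\<close>. With both equal to \<open>sqrt N\<close>, full gradients cost
  \<open>sqrt N\<close> per iteration on average and mini-batches \<open>2 * sqrt N\<close>.\<close>

lemma complexity:
  assumes gap: "objective N f h x0 - (INF z. objective N f h z) = ereal gap"
    and b: "real b = sqrt (real N)" and q: "real q = sqrt (real N)" and \<epsilon>: "\<epsilon> > 0"
    and R: "R = rbound L xbar vlow \<alpha> \<beta> \<theta> 1 gap"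
  shows "\<exists>t\<ge>1. (\<integral>\<^sup>+\<omega>. crit_residual N f h (x t \<omega>) \<partial>M) \<le> ennreal \<epsilon> \<and>
     real (grad_evals N q b t) \<le> (7 + 3 * R\<^sup>2) * (real N + sqrt (real N) / \<epsilon>\<^sup>2)"
proof -
  let ?u = "R\<^sup>2 / \<epsilon>\<^sup>2" and ?s = "sqrt (real N)"
  \<comment> \<open>The successor ensures at least one iteration even if the bound is zero, and
    rounding costs at most \<open>2\<close> in total.\<close>
  define T where "T = Suc (nat \<lceil>?u\<rceil>)"
  have u: "0 \<le> ?u" by simp
  have T: "T \<ge> 1" "?u \<le> real T" "real T \<le> ?u + 2"
    unfolding T_def using u by linarith+
  have \<rho>: "real q \<le> 1 * real b" using b q by simp
  obtain t where t: "t \<in> {1..T}" "(\<integral>\<^sup>+\<omega>. crit_residual N f h (x t \<omega>) \<partial>M) \<le> ennreal \<epsilon>"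
    using exists_small_residual[OF \<rho> gap T(1) \<epsilon>] T(2) unfolding R by blast
  have N: "real N \<ge> 1" using N_pos by simp
  have s: "1 \<le> ?s" "?s * ?s = real N" using N by simp_all
  then have sN: "?s \<le> real N" using mult_left_mono[of 1 ?s ?s] by simp
  have "real (grad_evals N q b t) = (\<Sum>s<t. if q dvd s then real N else real (2 * b))"
    unfolding grad_evals_def by (simp add: if_distrib[of real] cong: if_cong)
  also have "\<dots> \<le> real N * (real t / real q + 1) + real (2 * b) * real t"
    by (rule sum_dvd_le[OF q_pos]) auto
  also have "\<dots> = real N + 3 * ?s * real t"
  proof -
    have "real N / ?s = ?s" by (rule real_div_sqrt) simp
    moreover have "real N * (real t / ?s) = real N / ?s * real t" by simp
    ultimately have "real N * (real t / ?s) = ?s * real t" by (simp only:)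
    then show ?thesis using b q by (simp add: algebra_simps)
  qed
  also have "\<dots> \<le> real N + 3 * ?s * (?u + 2)"
    using t(1) T(3) by (intro add_left_mono mult_left_mono) auto
  also have "\<dots> = real N + 6 * ?s + 3 * R\<^sup>2 * (?s / \<epsilon>\<^sup>2)" by (simp add: algebra_simps)
  \<comment> \<open>Rounding contributes \<open>6 * sqrt N\<close>, which is absorbed into the cost
    of order \<open>N\<close> of the initial full gradient.\<close>
  also have "\<dots> \<le> 7 * real N + 3 * R\<^sup>2 * (?s / \<epsilon>\<^sup>2)" using sN by simp
  also have "\<dots> \<le> (7 + 3 * R\<^sup>2) * real N + (7 + 3 * R\<^sup>2) * (?s / \<epsilon>\<^sup>2)"
    using s by (intro add_mono mult_right_mono) auto
  finally show ?thesis using t by (intro exI[of _ t]) (auto simp: distrib_left)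
qed

end

theorem theorem3p8:
  fixes L xbar gap vlow \<alpha> \<beta> \<theta> :: real
  shows
    "(\<forall>N (f :: nat \<Rightarrow> real ^ 'n \<Rightarrow> real) h (M :: 'w measure) Fil q b x0 I x y v g sigma.
        aepg_spider N f h L xbar M Fil vlow \<alpha> \<beta> \<theta> q b x0 I x y v g sigma \<longrightarrow>
        (\<exists>vbar > 0.
           (\<forall>t. (\<integral>\<^sup>+\<omega>. ennreal (V_cal vlow \<alpha> \<beta> x v t \<omega>) \<partial>M) \<le> ennreal vbar) \<and>
           (\<forall>T\<ge>1. (\<integral>\<^sup>+\<omega>. ennreal (\<Sum>t\<le>T. (norm (x (Suc t) \<omega> - x t \<omega>))\<^sup>2) \<partial>M)
                    \<le> ennreal (1 / \<alpha> * ((vbar / vlow)\<^sup>2 - 1))) \<and>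
           (\<exists>C > 0. \<forall>T\<ge>1.
              (\<integral>\<^sup>+\<omega>. (\<Sum>t\<le>T. crit_residual N f h (x (Suc t) \<omega>)) / of_nat (T + 1) \<partial>M)
                \<le> ennreal (C / sqrt (real T))) \<and>
           (\<exists>C > 0. \<forall>\<epsilon> > 0. \<forall>T\<ge>1. real T \<ge> C / \<epsilon>\<^sup>2 \<longrightarrow>
              (\<exists>t\<in>{1..T}. (\<integral>\<^sup>+\<omega>. crit_residual N f h (x t \<omega>) \<partial>M) \<le> ennreal \<epsilon>))))
     \<and>
     (\<exists>C > 0. \<forall>N (f :: nat \<Rightarrow> real ^ 'n \<Rightarrow> real) h (M :: 'w measure) Fil q b x0 I x y v g sigma.
        aepg_spider N f h L xbar M Fil vlow \<alpha> \<beta> \<theta> q b x0 I x y v g sigma \<longrightarrow>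
        objective N f h x0 - (INF z. objective N f h z) = ereal gap \<longrightarrow>
        real b = sqrt (real N) \<longrightarrow> real q = sqrt (real N) \<longrightarrow>
        (\<forall>\<epsilon> > 0. \<exists>t\<ge>1.
           (\<integral>\<^sup>+\<omega>. crit_residual N f h (x t \<omega>) \<partial>M) \<le> ennreal \<epsilon> \<and>
           real (grad_evals N q b t) \<le> C * (real N + sqrt (real N) / \<epsilon>\<^sup>2)))"
proof (intro conjI allI impI)
  fix N and f :: "nat \<Rightarrow> real ^ 'n \<Rightarrow> real" and h and M :: "'w measure" and Fil q b x0 I x y v g sigma
  assume "aepg_spider N f h L xbar M Fil vlow \<alpha> \<beta> \<theta> q b x0 I x y v g sigma"
  then interpret aepg_spider N f h L xbar M Fil vlow \<alpha> \<beta> \<theta> q b x0 I x y v g sigma .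
  show "\<exists>vbar > 0.
     (\<forall>t. (\<integral>\<^sup>+\<omega>. ennreal (V_cal vlow \<alpha> \<beta> x v t \<omega>) \<partial>M) \<le> ennreal vbar) \<and>
     (\<forall>T\<ge>1. (\<integral>\<^sup>+\<omega>. ennreal (\<Sum>t\<le>T. (norm (x (Suc t) \<omega> - x t \<omega>))\<^sup>2) \<partial>M)
              \<le> ennreal (1 / \<alpha> * ((vbar / vlow)\<^sup>2 - 1))) \<and>
     (\<exists>C > 0. \<forall>T\<ge>1.
        (\<integral>\<^sup>+\<omega>. (\<Sum>t\<le>T. crit_residual N f h (x (Suc t) \<omega>)) / of_nat (T + 1) \<partial>M)
          \<le> ennreal (C / sqrt (real T))) \<and>
     (\<exists>C > 0. \<forall>\<epsilon> > 0. \<forall>T\<ge>1. real T \<ge> C / \<epsilon>\<^sup>2 \<longrightarrow>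
        (\<exists>t\<in>{1..T}. (\<integral>\<^sup>+\<omega>. crit_residual N f h (x t \<omega>) \<partial>M) \<le> ennreal \<epsilon>))"
    by (rule convergence_rates)
next
  \<comment> \<open>Fixed before \<open>N\<close> and the run are introduced: the constant depends
    on the fixed parameters and the initial gap only.\<close>
  define R where "R = rbound L xbar vlow \<alpha> \<beta> \<theta> 1 gap"
  show "\<exists>C > 0. \<forall>N (f :: nat \<Rightarrow> real ^ 'n \<Rightarrow> real) h (M :: 'w measure) Fil q b x0 I x y v g sigma.
        aepg_spider N f h L xbar M Fil vlow \<alpha> \<beta> \<theta> q b x0 I x y v g sigma \<longrightarrow>
        objective N f h x0 - (INF z. objective N f h z) = ereal gap \<longrightarrow>
        real b = sqrt (real N) \<longrightarrow> real q = sqrt (real N) \<longrightarrow>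
        (\<forall>\<epsilon> > 0. \<exists>t\<ge>1.
           (\<integral>\<^sup>+\<omega>. crit_residual N f h (x t \<omega>) \<partial>M) \<le> ennreal \<epsilon> \<and>
           real (grad_evals N q b t) \<le> C * (real N + sqrt (real N) / \<epsilon>\<^sup>2))"
    using aepg_spider.complexity[OF _ _ _ _ _ R_def]
    by (intro exI[of _ "7 + 3 * R\<^sup>2"] conjI allI impI) (simp add: add_pos_nonneg, blast)
qed

end
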